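(* Assume (A1), (A2) and (A3). Then there exists a deterministic $v\in\mathbb{R}^d$ such that $$\frac{X_n}{n}\longrightarrow v\quad\text{as } n\to\infty,\qquad \mathbb{P}^{\mathbf 0}\text{-almost surely}.$$
   Context: Setting. Fix $d\ge 1$. Let $\mathbf 0$ be the origin of $\mathbb{Z}^d$, $e_1,\dots,e_d$ the coordinate unit vectors, $N_{\mathbf 0}=\{\mathbf 0,\pm e_1,\dots,\pm e_d\}$, and $|\cdot|$ the $L_1$-norm on $\mathbb{Z}^d$. Let $\mathcal{S}$ be a collection of probability measures on $N_{\mathbf 0}$, assumed to be a Polish space, with Borel $\sigma$-field $\mathcal{B}_{\mathcal S}$ (the maps $s\mapsto s(e)$, $e\in N_{\mathbf 0}$, being Borel measurable). Let $K:\mathcal{S}\times\mathcal{B}_{\mathcal S}\to[0,1]$ be a Markov transition kernel with a unique stationary distribution $\pi$. Let $\mathbf{P}^{\pi}$ be the probability measure on $\Omega=(\mathcal{S}^{\{0,1,2,\dots\}})^{\mathbb{Z}^d}$ (product $\sigma$-algebra) under which, writing $\omega=(\omega_t(x))_{t\ge0,\,x\in\mathbb{Z}^d}$, the processes $(\omega_t(x))_{t\ge 0}$, $x\in\mathbb{Z}^d$, are i.i.d., each being a stationary Markov chain with transition kernel $K$ and marginal law $\pi$. Write $\omega_t(x,y)=\omega_t(x)(y-x)$ if $y-x\in N_{\mathbf 0}$ and $\omega_t(x,y)=0$ otherwise. Random walk. Given $\omega$, the quenched law $\mathbf{P}^{x}_{\omega}$ is the law of the time-inhomogeneous Markov chain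 $(X_t)_{t\ge0}$ on $\mathbb{Z}^d$ with $X_0=x$ and $\mathbf{P}_\omega(X_{t+1}=z\mid X_t=y)=\omega_t(y,z)$. The annealed law is $\mathbb{P}^{x}(F\times G)=\int_F \mathbf{P}^{x}_{\omega}(G)\,\mathbf{P}^{\pi}(d\omega)$; its marginal on paths $(X_t)_{t\ge0}$ is also denoted $\mathbb{P}^{x}$. Assumptions (with fixed $\kappa,\varepsilon,q$). (A1) $0<\kappa\le 1$ and $K(w,A)\ge\kappa\,\pi(A)$ for all $w\in\mathcal{S}$, $A\in\mathcal{B}_{\mathcal S}$. (A2) $0<\varepsilon<1$, and $q:\mathbb{Z}^d\times\mathbb{Z}^d\to[0,1]$ is a translation invariant Markov kernel, $q(x,y)=q(\mathbf 0,y-x)$, with only nearest neighbor transitions ($q(\mathbf 0,y)=0$ unless $|y|=1$), such that $\bigl|\sum_{y\in\mathbb{Z}^d:|y|=1}q(\mathbf 0,y)e^{i\ell\cdot y}\bigr|<1$ for all $\ell\in\mathbb{Z}^d\setminus\{\mathbf 0\}$, and $\mathbf{P}^{\pi}(\omega_t(x,y)\ge\varepsilon\,q(x,y))=1$ for all $x,y\in\mathbb{Z}^d$, $t\ge0$. (A3) $\kappa+\varepsilon^2>1$. *)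

theory Defs
  imports "HOL-Probability.Probability"
begin

section \<open>The lattice\<close>

definition l1_norm :: "int ^ 'd \<Rightarrow> int" where
  "l1_norm x = (\<Sum>i\<in>UNIV. \<bar>x $ i\<bar>)"

definition int_inner :: "int ^ 'd \<Rightarrow> int ^ 'd \<Rightarrow> int" where
  "int_inner x y = (\<Sum>i\<in>UNIV. x $ i * y $ i)"

definition real_vec :: "int ^ 'd \<Rightarrow> real ^ 'd" where
  "real_vec x = (\<chi> i. real_of_int (x $ i))"

definition nbhd0 :: "(int ^ 'd) set" where
  "nbhd0 = insert 0 (range (\<lambda>i. axis i 1) \<union> range (\<lambda>i. - axis i 1))"

section \<open>Polish spaces and Markov chains\<close>

text \<open>
  The topology on a collection of measures is part of the data, so we use abstract
  topologies instead of the class \<^class>\<open>polish_space\<close>.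
\<close>

definition polish_top :: "'a topology \<Rightarrow> bool" where
  "polish_top T \<longleftrightarrow> completely_metrizable_space T \<and> separable_space T"

definition borel_of_top :: "'a topology \<Rightarrow> 'a measure" where
  "borel_of_top T = sigma (topspace T) {U. openin T U}"

text \<open>Probability measures \<open>\<mu>\<close> on \<open>M\<close> with \<open>\<mu> K = \<mu>\<close>.\<close>

definition stationary_dist :: "'a measure \<Rightarrow> ('a \<Rightarrow> 'a measure) \<Rightarrow> 'a measure \<Rightarrow> bool" where
  "stationary_dist M K \<mu> \<longleftrightarrow> \<mu> \<in> space (prob_algebra M) \<and> \<mu> \<bind> K = \<mu>"

text \<open>
  Law, on the path space \<open>PiM UNIV (\<lambda>_. M)\<close>, of the Markov chain with initial law
  \<open>\<mu>\<close> whose step from time \<open>n\<close> to time \<open>n + 1\<close> has the kernel \<open>\<kappa> n\<close>. It is obtained from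
  the Ionescu-Tulcea theorem; in \<open>chain_step\<close> the argument \<open>x\<close> is the path before time \<open>n\<close>.
\<close>

definition chain_step ::
    "'a measure \<Rightarrow> (nat \<Rightarrow> 'a \<Rightarrow> 'a measure) \<Rightarrow> nat \<Rightarrow> (nat \<Rightarrow> 'a) \<Rightarrow> 'a measure" where
  "chain_step \<mu> \<kappa> n x = (case n of 0 \<Rightarrow> \<mu> | Suc m \<Rightarrow> \<kappa> m (x m))"

definition chain_law ::
    "'a measure \<Rightarrow> 'a measure \<Rightarrow> (nat \<Rightarrow> 'a \<Rightarrow> 'a measure) \<Rightarrow> (nat \<Rightarrow> 'a) measure" where
  "chain_law M \<mu> \<kappa> =
     projective_family.lim UNIV (Ionescu_Tulcea.CI (chain_step \<mu> \<kappa>) (\<lambda>_. M)) (\<lambda>_. M)"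

section \<open>Random walk in a dynamic random environment\<close>

text \<open>
  Measures on \<^const>\<open>nbhd0\<close> are values of type \<open>(int ^ 'd) pmf\<close> supported in \<^const>\<open>nbhd0\<close>;
  \<open>T\<close> is the topology on a collection of them, with underlying set \<open>topspace T\<close>.
  In an environment \<open>\<omega>\<close>, the measure used at the site \<open>x\<close> at time \<open>t\<close> is \<open>\<omega> x t\<close>.
\<close>

type_synonym 'd env = "int ^ 'd \<Rightarrow> nat \<Rightarrow> (int ^ 'd) pmf"

definition trans_prob :: "'d::finite env \<Rightarrow> nat \<Rightarrow> int ^ 'd \<Rightarrow> int ^ 'd \<Rightarrow> real" where
  "trans_prob \<omega> t x y = (if y - x \<in> nbhd0 then pmf (\<omega> x t) (y - x) else 0)"

definition env_space :: "(int ^ 'd::finite) pmf topology \<Rightarrow> 'd env measure" where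
  "env_space T = PiM UNIV (\<lambda>_. PiM UNIV (\<lambda>_. borel_of_top T))"

definition env_law ::
    "(int ^ 'd::finite) pmf topology \<Rightarrow> ((int ^ 'd) pmf \<Rightarrow> (int ^ 'd) pmf measure)
      \<Rightarrow> (int ^ 'd) pmf measure \<Rightarrow> 'd env measure" where
  "env_law T K \<pi> = PiM UNIV (\<lambda>_. chain_law (borel_of_top T) \<pi> (\<lambda>_. K))"

definition path_space :: "(nat \<Rightarrow> int ^ 'd::finite) measure" where
  "path_space = PiM UNIV (\<lambda>_. count_space UNIV)"

text \<open>
  The jump from \<open>y\<close> at time \<open>t\<close> is the image of \<open>\<omega> y t\<close> under \<open>e \<mapsto> y + e\<close>; see
  \<open>emeasure_quenched_cylinder\<close> below for the resulting transition probabilities.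
\<close>

definition quenched :: "'d::finite env \<Rightarrow> int ^ 'd \<Rightarrow> (nat \<Rightarrow> int ^ 'd) measure" where
  "quenched \<omega> x = chain_law (count_space UNIV) (return (count_space UNIV) x)
     (\<lambda>t y. measure_pmf (map_pmf (\<lambda>e. y + e) (\<omega> y t)))"

text \<open>The joint law of environment and walk, and its marginal on paths.\<close>

definition annealed ::
    "(int ^ 'd::finite) pmf topology \<Rightarrow> ((int ^ 'd) pmf \<Rightarrow> (int ^ 'd) pmf measure)
      \<Rightarrow> (int ^ 'd) pmf measure \<Rightarrow> int ^ 'd \<Rightarrow> ('d env \<times> (nat \<Rightarrow> int ^ 'd)) measure" where
  "annealed T K \<pi> x = env_law T K \<pi> \<bind>
     (\<lambda>\<omega>. distr (quenched \<omega> x) (env_space T \<Otimes>\<^sub>M path_space) (Pair \<omega>))"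

definition annealed_paths ::
    "(int ^ 'd::finite) pmf topology \<Rightarrow> ((int ^ 'd) pmf \<Rightarrow> (int ^ 'd) pmf measure)
      \<Rightarrow> (int ^ 'd) pmf measure \<Rightarrow> int ^ 'd \<Rightarrow> (nat \<Rightarrow> int ^ 'd) measure" where
  "annealed_paths T K \<pi> x = distr (annealed T K \<pi> x) path_space snd"


section \<open>The constructions are well defined\<close>

lemma sets_borel_of_top: "sets (borel_of_top T) = sigma_sets (topspace T) {U. openin T U}"
  unfolding borel_of_top_def by (rule sets_measure_of) (auto dest: openin_subset)

lemma space_borel_of_top [simp]: "space (borel_of_top T) = topspace T"
  unfolding borel_of_top_def by (rule space_measure_of) (auto dest: openin_subset)

lemma finite_nbhd0: "finite (nbhd0 :: (int ^ 'd::finite) set)"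
  by (simp add: nbhd0_def)

lemma nbhd0_eq: "(nbhd0 :: (int ^ 'd::finite) set) = {x. l1_norm x \<le> 1}"
proof (intro set_eqI iffI)
  fix x :: "int ^ 'd" assume "x \<in> nbhd0"
  moreover have "(\<Sum>i\<in>UNIV. \<bar>axis k (1::int) $ i\<bar>) = 1" for k :: 'd
    by (simp add: axis_def if_distrib cong: if_cong)
  ultimately show "x \<in> {x. l1_norm x \<le> 1}"
    by (auto simp: nbhd0_def l1_norm_def)
next
  fix x :: "int ^ 'd" assume "x \<in> {x. l1_norm x \<le> 1}"
  then have le: "(\<Sum>i\<in>UNIV. \<bar>x $ i\<bar>) \<le> 1" by (simp add: l1_norm_def)
  show "x \<in> nbhd0"
  proof (cases "x = 0")
    case False
    then obtain k where k: "x $ k \<noteq> 0" by (auto simp: vec_eq_iff)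
    have "(\<Sum>i\<in>UNIV. \<bar>x $ i\<bar>) = \<bar>x $ k\<bar> + (\<Sum>i\<in>UNIV - {k}. \<bar>x $ i\<bar>)"
      by (simp add: sum.remove)
    moreover have "(\<Sum>i\<in>UNIV - {k}. \<bar>x $ i\<bar>) \<ge> 0" by (simp add: sum_nonneg)
    ultimately have s0: "(\<Sum>i\<in>UNIV - {k}. \<bar>x $ i\<bar>) = 0" and k1: "\<bar>x $ k\<bar> = 1"
      using le k by linarith+
    from s0 have "\<forall>i\<in>UNIV - {k}. \<bar>x $ i\<bar> = 0"
      by (subst (asm) sum_nonneg_eq_0_iff) auto
    then have "x = axis k (x $ k)" by (auto simp: vec_eq_iff axis_def)
    moreover have "- axis k (1::int) = axis k (-1)" by (auto simp: vec_eq_iff axis_def)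
    moreover have "x $ k = 1 \<or> x $ k = -1" using k1 by linarith
    ultimately show ?thesis unfolding nbhd0_def by (metis UnCI insertCI rangeI)
  qed (simp add: nbhd0_def)
qed

lemma finite_l1_norm_eq_1: "finite {y :: int ^ 'd::finite. l1_norm y = 1}"
  by (rule finite_subset[OF _ finite_nbhd0]) (auto simp: nbhd0_eq)

lemma Ionescu_Tulcea_chain_step:
  assumes \<mu>: "\<mu> \<in> space (prob_algebra M)"
    and \<kappa>: "\<And>n. \<kappa> n \<in> M \<rightarrow>\<^sub>M prob_algebra M"
  shows "Ionescu_Tulcea (chain_step \<mu> \<kappa>) (\<lambda>_. M)"
proof -
  have "chain_step \<mu> \<kappa> n \<in> PiM {0..<n} (\<lambda>_. M) \<rightarrow>\<^sub>M prob_algebra M" for n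
  proof (cases n)
    case 0
    then show ?thesis using \<mu> by (simp add: chain_step_def[abs_def])
  next
    case (Suc m)
    have "(\<lambda>x. x m) \<in> PiM {0..<n} (\<lambda>_. M) \<rightarrow>\<^sub>M M"
      using Suc by (intro measurable_component_singleton) auto
    from measurable_compose[OF this \<kappa>[of m]] show ?thesis
      using Suc by (simp add: chain_step_def[abs_def])
  qed
  note m = this
  have "prob_space (chain_step \<mu> \<kappa> n x)" if "x \<in> space (PiM {0..<n} (\<lambda>_. M))" for n x
    using measurable_space[OF m that] by (simp add: space_prob_algebra)
  then show ?thesis
    by (intro Ionescu_Tulcea.intro measurable_prob_algebraD m)
qed

lemma chain_law_prob_algebra:
  assumes "\<mu> \<in> space (prob_algebra M)" "\<And>n. \<kappa> n \<in> M \<rightarrow>\<^sub>M prob_algebra M"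
  shows "chain_law M \<mu> \<kappa> \<in> space (prob_algebra (PiM UNIV (\<lambda>_. M)))"
proof -
  interpret Ionescu_Tulcea "chain_step \<mu> \<kappa>" "\<lambda>_. M"
    by (rule Ionescu_Tulcea_chain_step) fact+
  have "prob_space PF.lim"
  proof
    have "emeasure PF.lim (PF.emb UNIV {} {\<lambda>_. undefined}) = emeasure (CI {}) {\<lambda>_. undefined}"
      by (rule lim) (auto simp: sets_PiM_empty)
    moreover have "PF.emb UNIV {} {\<lambda>_. undefined} = space PF.lim"
      by (auto simp: prod_emb_def restrict_def space_PiM sets_eq_imp_space_eq[OF PF.sets_lim])
    moreover have "emeasure (CI {}) (space (CI {})) = 1"
      by (intro prob_space.emeasure_space_1 PF.prob_space_P) auto
    ultimately show "emeasure PF.lim (space PF.lim) = 1"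
      by (simp add: PF.space_P space_PiM)
  qed
  then show ?thesis by (simp add: chain_law_def space_prob_algebra PF.sets_lim)
qed

text \<open>The one-step recursion for the law of a chain up to time \<open>n\<close>, which determines that law.\<close>

lemma emeasure_chain_law_Suc:
  assumes \<mu>: "\<mu> \<in> space (prob_algebra M)" and \<kappa>: "\<And>n. \<kappa> n \<in> M \<rightarrow>\<^sub>M prob_algebra M"
    and A: "\<And>i. A i \<in> sets M"
  shows "emeasure (chain_law M \<mu> \<kappa>) {X \<in> space (PiM UNIV (\<lambda>_. M)). X 0 \<in> A 0} = emeasure \<mu> (A 0)"
    and "emeasure (chain_law M \<mu> \<kappa>) {X \<in> space (PiM UNIV (\<lambda>_. M)). \<forall>i\<le>Suc n. X i \<in> A i} =
      (\<integral>\<^sup>+X. indicator {X. \<forall>i\<le>n. X i \<in> A i} X * emeasure (\<kappa> n (X n)) (A (Suc n)) \<partial>chain_law M \<mu> \<kappa>)"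
proof -
  interpret Ionescu_Tulcea "chain_step \<mu> \<kappa>" "\<lambda>_. M"
    by (rule Ionescu_Tulcea_chain_step) fact+
  note [measurable] = A \<kappa>[THEN measurable_prob_algebraD]
  let ?M = "\<lambda>_::nat. M"
  have L: "chain_law M \<mu> \<kappa> = PF.lim" by (simp add: chain_law_def)
  have CI: "CI {0..<k} = C 0 k (\<lambda>_. undefined)" for k
  proof (rule measure_eqI)
    show "sets (CI {0..<k}) = sets (C 0 k (\<lambda>_. undefined))"
      by (simp add: PF.sets_P sets_C)
    fix B assume "B \<in> sets (CI {0..<k})"
    then have B: "B \<in> sets (PiM {0..<k} ?M)" by (simp add: PF.sets_P)
    show "emeasure (CI {0..<k}) B = emeasure (C 0 k (\<lambda>_. undefined)) B"
      using sets.sets_into_space[OF B]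
      by (subst emeasure_CI[OF subset_refl B]) (simp add: prod_emb_id space_PiM)
  qed
  have D: "C 0 k (\<lambda>_. undefined) = distr PF.lim (PiM {0..<k} ?M) (\<lambda>x. restrict x {0..<k})" for k
    by (simp add: distr_lim CI)
  have E: "emeasure PF.lim {X \<in> space (PiM UNIV ?M). \<forall>i\<in>{0..<k}. X i \<in> A i}
      = emeasure (C 0 k (\<lambda>_. undefined)) (PiE {0..<k} A)" for k
  proof -
    have "emeasure PF.lim (PF.emb UNIV {0..<k} (PiE {0..<k} A)) = emeasure (CI {0..<k}) (PiE {0..<k} A)"
      by (rule lim) (auto intro!: sets_PiM_I_finite)
    moreover have "PF.emb UNIV {0..<k} (PiE {0..<k} A) = {X \<in> space (PiM UNIV ?M). \<forall>i\<in>{0..<k}. X i \<in> A i}"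
      by (auto simp: prod_emb_def space_PiM PiE_iff)
    ultimately show ?thesis by (simp add: CI)
  qed
  have S: "emeasure (C 0 (Suc k) (\<lambda>_. undefined)) (PiE {0..<Suc k} A)
      = (\<integral>\<^sup>+x. indicator (PiE {0..<k} A) x * emeasure (chain_step \<mu> \<kappa> k x) (A k) \<partial>C 0 k (\<lambda>_. undefined))" for k
  proof -
    have SA: "PiE {0..<Suc k} A \<in> sets (PiM {0..<Suc k} ?M)"
      by (auto intro!: sets_PiM_I_finite)
    have "emeasure (C 0 (Suc k) (\<lambda>_. undefined)) (PiE {0..<Suc k} A)
        = (\<integral>\<^sup>+x. emeasure (eP k x) (PiE {0..<Suc k} A) \<partial>C 0 k (\<lambda>_. undefined))"
      using SA by (simp, subst emeasure_bind[where N="PiM {0..<Suc k} ?M"])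
        (auto simp: space_C measurable_cong_sets[OF sets_C refl] intro!: measurable_eP)
    also have "\<dots> = (\<integral>\<^sup>+x. indicator (PiE {0..<k} A) x * emeasure (chain_step \<mu> \<kappa> k x) (A k) \<partial>C 0 k (\<lambda>_. undefined))"
    proof (rule nn_integral_cong)
      fix x assume "x \<in> space (C 0 k (\<lambda>_. undefined))"
      then have x: "x \<in> space (PiM {0..<k} ?M)" by (simp add: space_C)
      have "(\<lambda>a. x(k := a)) -` PiE {0..<Suc k} A \<inter> space M = (if x \<in> PiE {0..<k} A then A k else {})"
        using x sets.sets_into_space[OF A[of k]]
        by (auto simp: space_PiM PiE_iff extensional_def atLeastLessThanSuc split: if_splits)
      then show "emeasure (eP k x) (PiE {0..<Suc k} A) = indicator (PiE {0..<k} A) x * emeasure (chain_step \<mu> \<kappa> k x) (A k)"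
        by (simp add: emeasure_eP[OF x SA])
    qed
    finally show ?thesis .
  qed
  show "emeasure (chain_law M \<mu> \<kappa>) {X \<in> space (PiM UNIV ?M). X 0 \<in> A 0} = emeasure \<mu> (A 0)"
  proof -
    have "(\<integral>\<^sup>+x. indicator {\<lambda>_. undefined} x * emeasure \<mu> (A 0)
        \<partial>return (PiM {} ?M) (\<lambda>_. undefined)) = emeasure \<mu> (A 0)"
      by (subst nn_integral_return)
        (auto simp: space_PiM sets_PiM_empty intro!: borel_measurable_times_ennreal borel_measurable_indicator)
    then show ?thesis
      using E[of 1] S[of 0] by (simp add: L chain_step_def)
  qed
  have "emeasure PF.lim {X \<in> space (PiM UNIV ?M). \<forall>i\<in>{0..<Suc (Suc n)}. X i \<in> A i}
     = (\<integral>\<^sup>+x. indicator (PiE {0..<Suc n} A) x * emeasure (\<kappa> n (x n)) (A (Suc n))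
          \<partial>distr PF.lim (PiM {0..<Suc n} ?M) (\<lambda>x. restrict x {0..<Suc n}))"
    unfolding E S by (simp add: chain_step_def D del: C.simps)
  also have "\<dots> = (\<integral>\<^sup>+x. indicator (PiE {0..<Suc n} A) (restrict x {0..<Suc n}) *
      emeasure (\<kappa> n (restrict x {0..<Suc n} n)) (A (Suc n)) \<partial>PF.lim)"
  proof -
    have r: "(\<lambda>x. restrict x {0..<Suc n}) \<in> PF.lim \<rightarrow>\<^sub>M PiM {0..<Suc n} ?M"
      by (simp add: measurable_cong_sets[OF PF.sets_lim refl] measurable_restrict_subset)
    have [measurable]: "PiE {0..<Suc n} A \<in> sets (PiM {0..<Suc n} ?M)"
      by (auto intro!: sets_PiM_I_finite)
    have [measurable]: "(\<lambda>x. x n) \<in> PiM {0..<Suc n} ?M \<rightarrow>\<^sub>M M"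
      by (intro measurable_component_singleton) auto
    have "(\<lambda>x. indicator (PiE {0..<Suc n} A) x * emeasure (\<kappa> n (x n)) (A (Suc n)))
        \<in> borel_measurable (PiM {0..<Suc n} ?M)"
      by measurable
    then show ?thesis
      by (intro nn_integral_distr[OF r]) (simp add: measurable_distr_eq1)
  qed
  also have "\<dots> = (\<integral>\<^sup>+X. indicator {X. \<forall>i\<le>n. X i \<in> A i} X * emeasure (\<kappa> n (X n)) (A (Suc n)) \<partial>PF.lim)"
    by (intro nn_integral_cong) (auto simp: PiE_iff less_Suc_eq_le split: split_indicator)
  finally show "emeasure (chain_law M \<mu> \<kappa>) {X \<in> space (PiM UNIV ?M). \<forall>i\<le>Suc n. X i \<in> A i} =
      (\<integral>\<^sup>+X. indicator {X. \<forall>i\<le>n. X i \<in> A i} X * emeasure (\<kappa> n (X n)) (A (Suc n)) \<partial>chain_law M \<mu> \<kappa>)"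
    by (simp add: L Ball_def less_Suc_eq_le)
qed

lemma space_path_space [simp]: "space path_space = UNIV"
  by (simp add: path_space_def space_PiM)

lemma quenched_kernel:
  "(\<lambda>y. measure_pmf (map_pmf (\<lambda>e. y + e) (\<omega> y t))) \<in> count_space UNIV \<rightarrow>\<^sub>M prob_algebra (count_space UNIV)"
  by (simp add: space_prob_algebra measure_pmf.prob_space_axioms)

lemma quenched_prob_algebra: "quenched \<omega> x \<in> space (prob_algebra path_space)"
  unfolding quenched_def path_space_def
  by (intro chain_law_prob_algebra quenched_kernel) (simp add: space_prob_algebra prob_space_return)

lemma trans_prob_eq_pmf:
  assumes "set_pmf (\<omega> y t) \<subseteq> nbhd0"
  shows "trans_prob \<omega> t y z = pmf (map_pmf (\<lambda>e. y + e) (\<omega> y t)) z"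
proof -
  have "pmf (map_pmf (\<lambda>e. y + e) (\<omega> y t)) (y + (z - y)) = pmf (\<omega> y t) (z - y)"
    by (rule pmf_map_inj') (auto simp: inj_def)
  then show ?thesis using assms by (auto simp: trans_prob_def pmf_eq_0_set_pmf)
qed

lemma emeasure_quenched_cylinder:
  assumes "\<And>y t. set_pmf (\<omega> y t) \<subseteq> nbhd0"
  shows "emeasure (quenched \<omega> x) {X. \<forall>i\<le>n. X i = y i} =
    (if y 0 = x then ennreal (\<Prod>i<n. trans_prob \<omega> i (y i) (y (Suc i))) else 0)"
proof (induction n)
  case 0
  have "emeasure (quenched \<omega> x) {X \<in> space path_space. X 0 \<in> {y 0}} = emeasure (return (count_space UNIV) x) {y 0}"
    unfolding quenched_def path_space_def
    by (rule emeasure_chain_law_Suc(1)[where A="\<lambda>i. {y i}"])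
      (auto simp: space_prob_algebra prob_space_return measure_pmf.prob_space_axioms)
  then show ?case by (simp add: indicator_def)
next
  case (Suc n)
  have sq: "sets (quenched \<omega> x) = sets path_space"
    using quenched_prob_algebra[of \<omega> x] by (simp add: space_prob_algebra)
  let ?c = "ennreal (trans_prob \<omega> n (y n) (y (Suc n)))"
  have "(\<lambda>X. X i) \<in> path_space \<rightarrow>\<^sub>M count_space UNIV" for i :: nat
    unfolding path_space_def by (rule measurable_component_singleton) simp
  then have "{X \<in> space path_space. X i = y i} \<in> sets path_space" for i
    by measurable
  then have "(\<Inter>i\<in>{..n}. {X \<in> space path_space. X i = y i}) \<in> sets path_space"
    by (intro sets.finite_INT) auto
  moreover have "(\<Inter>i\<in>{..n}. {X \<in> space path_space. X i = y i}) = {X. \<forall>i\<le>n. X i = y i}"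
    by auto
  ultimately have ms: "{X. \<forall>i\<le>n. X i = y i} \<in> sets (quenched \<omega> x)" by (simp add: sq)
  have "emeasure (quenched \<omega> x) {X \<in> space path_space. \<forall>i\<le>Suc n. X i \<in> {y i}} =
      (\<integral>\<^sup>+X. indicator {X. \<forall>i\<le>n. X i \<in> {y i}} X *
        emeasure (measure_pmf (map_pmf (\<lambda>e. X n + e) (\<omega> (X n) n))) {y (Suc n)} \<partial>quenched \<omega> x)"
    unfolding quenched_def path_space_def
    by (rule emeasure_chain_law_Suc(2)[where A="\<lambda>i. {y i}"])
      (auto simp: space_prob_algebra prob_space_return measure_pmf.prob_space_axioms)
  also have "\<dots> = (\<integral>\<^sup>+X. ?c * indicator {X. \<forall>i\<le>n. X i = y i} X \<partial>quenched \<omega> x)"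
    by (intro nn_integral_cong)
      (auto simp: emeasure_pmf_single trans_prob_eq_pmf[OF assms] split: split_indicator)
  also have "\<dots> = ?c * emeasure (quenched \<omega> x) {X. \<forall>i\<le>n. X i = y i}"
    using ms by (simp add: nn_integral_cmult_indicator)
  finally show ?case
    using Suc by (simp add: ennreal_mult'' [symmetric] mult.commute trans_prob_def prod_nonneg)
qed

lemma env_in_topspace:
  assumes "\<omega> \<in> space (env_space T)"
  shows "\<omega> x t \<in> topspace T"
  using assms by (auto simp: env_space_def space_PiM PiE_iff)

lemma quenched_measurable:
  assumes supp: "\<And>s. s \<in> topspace T \<Longrightarrow> set_pmf s \<subseteq> nbhd0"
    and eval: "\<And>e. e \<in> nbhd0 \<Longrightarrow> (\<lambda>s. pmf s e) \<in> borel_measurable (borel_of_top T)"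
  shows "(\<lambda>\<omega>. quenched \<omega> x) \<in> env_space T \<rightarrow>\<^sub>M prob_algebra path_space"
proof -
  define cyl where "cyl n y = {X :: nat \<Rightarrow> int ^ 'a. \<forall>i\<le>n. X i = y i}" for n :: nat and y
  let ?G = "insert {} (range (\<lambda>(n, y). cyl n y))"
  have tm: "(\<lambda>\<omega>. trans_prob \<omega> t y z) \<in> borel_measurable (env_space T)" for t y z
  proof (cases "z - y \<in> nbhd0")
    case True
    have "(\<lambda>\<omega>. \<omega> y t) \<in> env_space T \<rightarrow>\<^sub>M borel_of_top T"
      unfolding env_space_def
      using measurable_compose[OF
          measurable_component_singleton[of y UNIV "\<lambda>_. PiM UNIV (\<lambda>_. borel_of_top T)"]
          measurable_component_singleton[of t UNIV "\<lambda>_. borel_of_top T"]] by simp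
    from measurable_compose[OF this eval[OF True]] show ?thesis
      using True by (simp add: trans_prob_def)
  qed (simp add: trans_prob_def)
  have single: "{X. X i = z} = (\<Union>w\<in>{w. length w = Suc i \<and> w ! i = z}. cyl i (\<lambda>j. w ! j))" for i and z :: "int ^ 'a"
  proof (intro set_eqI iffI)
    fix X assume "X \<in> {X. X i = z}"
    then show "X \<in> (\<Union>w\<in>{w. length w = Suc i \<and> w ! i = z}. cyl i (\<lambda>j. w ! j))"
      by (intro UN_I[of "map X [0..<Suc i]"])
        (auto simp: cyl_def less_Suc_eq_le simp del: upt_Suc)
  qed (auto simp: cyl_def)
  interpret S: sigma_algebra UNIV "sigma_sets UNIV ?G"
    by (rule sigma_algebra_sigma_sets) simp
  have cs: "cyl n y \<in> sigma_sets UNIV ?G" for n y by (intro sigma_sets.Basic) auto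
  have eq: "sets path_space = sigma_sets UNIV ?G"
  proof (rule antisym)
    have "{f. f i \<in> A} \<in> sigma_sets UNIV ?G" for i :: nat and A :: "(int ^ 'a) set"
    proof -
      have eq: "{f. f i \<in> A} = (\<Union>z\<in>A. {X. X i = z})"
        by auto
      show ?thesis
        unfolding eq single by (intro S.countable_UN'' countableI_type cs)
    qed
    then have "{{f \<in> UNIV \<rightarrow>\<^sub>E space (count_space UNIV). f i \<in> A} | (i :: nat) (A :: (int ^ 'a) set).
        i \<in> UNIV \<and> A \<in> sets (count_space UNIV)} \<subseteq> sigma_sets UNIV ?G"
      by (intro subsetI, elim CollectE exE conjE) simp
    from S.sigma_sets_subset[OF this] show "sets path_space \<subseteq> sigma_sets UNIV ?G"
      unfolding path_space_def sets_PiM_single by simp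
    have m: "(\<lambda>X. X i) \<in> path_space \<rightarrow>\<^sub>M count_space UNIV" for i :: nat
      unfolding path_space_def by (rule measurable_component_singleton) simp
    have "cyl n y \<in> sets path_space" for n y
    proof -
      from m have "{X \<in> space path_space. X i = y i} \<in> sets path_space" for i by measurable
      then have "(\<Inter>i\<in>{..n}. {X \<in> space path_space. X i = y i}) \<in> sets path_space"
        by (intro sets.finite_INT) auto
      moreover have "(\<Inter>i\<in>{..n}. {X \<in> space path_space. X i = y i}) = cyl n y"
        by (auto simp: cyl_def)
      ultimately show ?thesis by simp
    qed
    then have "?G \<subseteq> sets path_space" by auto
    from sets.sigma_sets_subset[OF this] show "sigma_sets UNIV ?G \<subseteq> sets path_space"
      by simp
  qed
  show ?thesis
  proof (rule measurable_prob_algebra_generated[OF eq])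
    show "Int_stable ?G"
    proof (rule Int_stableI)
      have *: "cyl n y \<inter> cyl m z = {} \<or> cyl n y \<inter> cyl m z = cyl m z" if "n \<le> m" for n m y z
      proof (cases "\<forall>i\<le>n. z i = y i")
        case True
        then show ?thesis using that by (auto simp: cyl_def)
      next
        case False
        then obtain i where "i \<le> n" "z i \<noteq> y i" by auto
        then show ?thesis using that by (force simp: cyl_def)
      qed
      have **: "cyl n y \<inter> cyl m z \<in> ?G" for n m y z
        using *[of n m y z] *[of m n z y] by (cases "n \<le> m") (auto simp: Int_commute)
      fix a b assume "a \<in> ?G" "b \<in> ?G"
      then consider "a = {} \<or> b = {}" | n y m z where "a = cyl n y" "b = cyl m z" by auto
      then show "a \<inter> b \<in> ?G"
      proof cases
        case 2
        then show ?thesis using ** by simp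
      qed auto
    qed
    show "prob_space (quenched \<omega> x)" "sets (quenched \<omega> x) = sets path_space" for \<omega>
      using quenched_prob_algebra[of \<omega> x] by (simp_all add: space_prob_algebra)
    fix A assume "A \<in> ?G"
    then consider "A = {}" | n y where "A = cyl n y" by auto
    then show "(\<lambda>\<omega>. emeasure (quenched \<omega> x) A) \<in> borel_measurable (env_space T)"
    proof cases
      case 2
      have "(\<lambda>\<omega>. if y 0 = x then ennreal (\<Prod>i<n. trans_prob \<omega> i (y i) (y (Suc i))) else 0)
          \<in> borel_measurable (env_space T)"
        using tm by measurable
      also have "?this \<longleftrightarrow> ?thesis"
        unfolding 2 cyl_def
        by (intro measurable_cong emeasure_quenched_cylinder[symmetric] supp env_in_topspace)
      finally show ?thesis .
    qed simp
  qed simp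
qed

lemma env_law_prob_algebra:
  assumes "stationary_dist (borel_of_top T) K \<pi>"
    and "K \<in> borel_of_top T \<rightarrow>\<^sub>M prob_algebra (borel_of_top T)"
  shows "env_law T K \<pi> \<in> space (prob_algebra (env_space T))"
proof -
  have c: "chain_law (borel_of_top T) \<pi> (\<lambda>_. K) \<in> space (prob_algebra (PiM UNIV (\<lambda>_. borel_of_top T)))"
    using assms by (intro chain_law_prob_algebra) (auto simp: stationary_dist_def)
  then show ?thesis
    unfolding env_law_def env_space_def
    by (auto simp: space_prob_algebra intro!: prob_space_PiM sets_PiM_cong)
qed

lemma
  assumes supp: "\<And>s. s \<in> topspace T \<Longrightarrow> set_pmf s \<subseteq> nbhd0"
    and eval: "\<And>e. e \<in> nbhd0 \<Longrightarrow> (\<lambda>s. pmf s e) \<in> borel_measurable (borel_of_top T)"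
    and stat: "stationary_dist (borel_of_top T) K \<pi>"
    and K: "K \<in> borel_of_top T \<rightarrow>\<^sub>M prob_algebra (borel_of_top T)"
  shows annealed_prob_algebra:
      "annealed T K \<pi> x \<in> space (prob_algebra (env_space T \<Otimes>\<^sub>M path_space))"
    and emeasure_annealed_Times:
      "F \<in> sets (env_space T) \<Longrightarrow> G \<in> sets path_space \<Longrightarrow>
        emeasure (annealed T K \<pi> x) (F \<times> G)
          = (\<integral>\<^sup>+\<omega>. indicator F \<omega> * emeasure (quenched \<omega> x) G \<partial>env_law T K \<pi>)"
proof -
  note [measurable] = quenched_measurable[OF supp eval]
  note E = env_law_prob_algebra[OF stat K]
  then have sE: "sets (env_law T K \<pi>) = sets (env_space T)" by (simp add: space_prob_algebra)
  let ?k = "\<lambda>\<omega>. distr (quenched \<omega> x) (env_space T \<Otimes>\<^sub>M path_space) (Pair \<omega>)"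
  have k: "?k \<in> env_space T \<rightarrow>\<^sub>M prob_algebra (env_space T \<Otimes>\<^sub>M path_space)"
    by (rule measurable_distr_prob_space2[where M=path_space]) measurable
  show "annealed T K \<pi> x \<in> space (prob_algebra (env_space T \<Otimes>\<^sub>M path_space))"
    unfolding annealed_def using prob_space_bind'[OF E k] sets_bind'[OF E k]
    by (simp add: space_prob_algebra)
  assume F: "F \<in> sets (env_space T)" and G: "G \<in> sets path_space"
  have "emeasure (annealed T K \<pi> x) (F \<times> G) = (\<integral>\<^sup>+\<omega>. emeasure (?k \<omega>) (F \<times> G) \<partial>env_law T K \<pi>)"
    unfolding annealed_def using F G by (intro emeasure_bind_prob_algebra[OF E k]) simp
  also have "\<dots> = (\<integral>\<^sup>+\<omega>. indicator F \<omega> * emeasure (quenched \<omega> x) G \<partial>env_law T K \<pi>)"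
  proof (rule nn_integral_cong)
    fix \<omega> assume "\<omega> \<in> space (env_law T K \<pi>)"
    then have w: "\<omega> \<in> space (env_space T)" using sets_eq_imp_space_eq[OF sE] by simp
    have sq: "sets (quenched \<omega> x) = sets path_space"
      using quenched_prob_algebra[of \<omega> x] by (simp add: space_prob_algebra)
    have "Pair \<omega> \<in> quenched \<omega> x \<rightarrow>\<^sub>M env_space T \<Otimes>\<^sub>M path_space"
      using w by (simp add: measurable_cong_sets[OF sq refl])
    moreover have "Pair \<omega> -` (F \<times> G) \<inter> space (quenched \<omega> x) = (if \<omega> \<in> F then G else {})"
      using sets_eq_imp_space_eq[OF sq] by auto
    ultimately show "emeasure (?k \<omega>) (F \<times> G) = indicator F \<omega> * emeasure (quenched \<omega> x) G"
      using F G by (simp add: emeasure_distr)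
  qed
  finally show "emeasure (annealed T K \<pi> x) (F \<times> G)
      = (\<integral>\<^sup>+\<omega>. indicator F \<omega> * emeasure (quenched \<omega> x) G \<partial>env_law T K \<pi>)" .
qed

end

theory Submission
  imports Defs
begin

text \<open>
  By the minorization (A1), each site is refreshed at each time step, independently and with
  probability \<open>\<kappa>\<close>, from the law \<open>\<pi>\<close>. Given the path of the walk, the environment is a product of laws,
  all equal to \<open>\<pi>\<close> except at the sites visited since their last refresh. The number of these sites
  grows by at most one per step while each of them disappears with probability \<open>\<kappa>\<close>, so it
  returns to zero quickly, and then the walk starts afresh. Hence the mean displacement
  over \<open>n\<close> steps depends on the initial environment only up to \<open>o(n)\<close>, uniformly over all initial
  environments, because only polynomially many sites are within reach. Splitting time into blocks
  gives a second moment bound for the displacement, and the almost sure convergence follows along the times \<open>j\<^sup>8\<close>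
  by summability and in between because jumps are bounded.
\<close>

section \<open>Laws of single sites\<close>

text \<open>The jump made at a site biases the conditional law of that site, and the walk may return
  to biased sites. Comparison with the stationary start is exact only once no biased site is left. A
  step adds at most the current site to k biased ones, and all k + 1 are refreshed together with
  probability \<kappa>^(k+1), positive but tiny for large k; this forces an error bound with a jump
  at k > 0 plus a term linear in k. From an arbitrary environment, with about n^d sites in reach,
  such a bound is too weak by itself, so m steps are spent on shrinking the linear coefficient by 1
  - \<kappa> each, at a cost of order m.

  No coupling or regeneration time is constructed. Jumps take finitely many values, so all means are
  finite sums, and refreshing enters through the fact that these means are affine in the law of each
  single site. With laws as functionals, both Bayes conditioning and the remainder of the
  minorization are explicit formulas. Measures on path space enter only where cylinder probabilities
  are identified with the weights in these sums.\<close>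

text \<open>A law \<open>\<mu>\<close> of the state of one site is represented by the functional \<open>g \<mapsto> \<integral> g d\<mu>\<close>;
  only its values on bounded measurable functions matter.\<close>

type_synonym 's state = "('s \<Rightarrow> real) \<Rightarrow> real"

locale minorized_environment =
  fixes M :: "'s measure" and K :: "'s \<Rightarrow> 's measure" and \<pi> :: "'s measure"
    and w :: "int ^ 'd::finite \<Rightarrow> 's \<Rightarrow> real" and \<kappa> :: real
  assumes kernel: "K \<in> M \<rightarrow>\<^sub>M prob_algebra M"
    and stationary: "stationary_dist M K \<pi>"
    and w_measurable: "\<And>e. e \<in> nbhd0 \<Longrightarrow> w e \<in> borel_measurable M"
    and w_nonneg: "\<And>e s. s \<in> space M \<Longrightarrow> 0 \<le> w e s"
    and w_sum: "\<And>s. s \<in> space M \<Longrightarrow> (\<Sum>e\<in>nbhd0. w e s) = 1"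
    and \<kappa>: "0 < \<kappa>" "\<kappa> \<le> 1"
    and minorization: "\<And>s A. s \<in> space M \<Longrightarrow> A \<in> sets M \<Longrightarrow> \<kappa> * measure \<pi> A \<le> measure (K s) A"
begin

definition bfun :: "('s \<Rightarrow> real) set" where
  "bfun = {g \<in> borel_measurable M. \<exists>C. \<forall>s\<in>space M. \<bar>g s\<bar> \<le> C}"

definition Kop :: "('s \<Rightarrow> real) \<Rightarrow> 's \<Rightarrow> real" where
  "Kop g s = (\<integral>u. g u \<partial>K s)"

text \<open>Finitely additive laws: only finite linear combinations of test functions are ever
  formed. Values outside \<open>bfun\<close> are unconstrained, so two states count as equal when
  they agree on \<open>bfun\<close>.\<close>

definition is_state :: "'s state \<Rightarrow> bool" where
  "is_state L \<longleftrightarrow>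
     (\<forall>g\<in>bfun. \<forall>h\<in>bfun. \<forall>a b. L (\<lambda>s. a * g s + b * h s) = a * L g + b * L h) \<and>
     (\<forall>g\<in>bfun. (\<forall>s\<in>space M. 0 \<le> g s) \<longrightarrow> 0 \<le> L g) \<and> L (\<lambda>_. 1) = 1"

definition stat :: "'s state" where
  "stat g = (\<integral>s. g s \<partial>\<pi>)"

definition evolve :: "'s state \<Rightarrow> 's state" where
  "evolve L g = L (Kop g)"

text \<open>Conditioning on a jump \<open>e\<close> of probability zero gives \<open>stat\<close>, so that \<open>cond\<close> always yields a state.\<close>

definition cond :: "int ^ 'd \<Rightarrow> 's state \<Rightarrow> 's state" where
  "cond e L g = (if L (w e) = 0 then stat g else L (\<lambda>s. w e s * g s) / L (w e))"

text \<open>Given the path of the walk, the sites of the environment stay independent: a jump \<open>e\<close> from \<open>x\<close>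
  conditions the law of the site \<open>x\<close>, and then every site makes one step of the chain \<open>K\<close>.\<close>

definition step :: "(int ^ 'd \<Rightarrow> 's state) \<Rightarrow> int ^ 'd \<Rightarrow> int ^ 'd \<Rightarrow> int ^ 'd \<Rightarrow> 's state" where
  "step L x e = (\<lambda>y. evolve (if y = x then cond e (L x) else L y))"

lemma prob_\<pi>: "prob_space \<pi>" and sets_\<pi> [measurable_cong]: "sets \<pi> = sets M"
  using stationary by (auto simp: stationary_dist_def space_prob_algebra)

lemma space_\<pi>: "space \<pi> = space M"
  using sets_\<pi> by (rule sets_eq_imp_space_eq)

lemma prob_K: "s \<in> space M \<Longrightarrow> prob_space (K s)"
  and sets_K: "s \<in> space M \<Longrightarrow> sets (K s) = sets M"
  using measurable_space[OF kernel, of s] by (auto simp: space_prob_algebra)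

lemma space_K: "s \<in> space M \<Longrightarrow> space (K s) = space M"
  using sets_K by (rule sets_eq_imp_space_eq)

section \<open>Bounded test functions and the action of the kernel on them\<close>

lemma bfun_const [simp]: "(\<lambda>_. c) \<in> bfun"
  by (auto simp: bfun_def)

lemma bfun_lin:
  assumes "g \<in> bfun" "h \<in> bfun"
  shows "(\<lambda>s. a * g s + b * h s) \<in> bfun"
proof -
  from assms obtain C D where m: "g \<in> borel_measurable M" "h \<in> borel_measurable M"
    and b: "\<And>s. s \<in> space M \<Longrightarrow> \<bar>g s\<bar> \<le> C" "\<And>s. s \<in> space M \<Longrightarrow> \<bar>h s\<bar> \<le> D"
    by (auto simp: bfun_def)
  have "\<bar>a * g s + b * h s\<bar> \<le> \<bar>a\<bar> * C + \<bar>b\<bar> * D" if "s \<in> space M" for s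
    using mult_left_mono[OF b(1)[OF that], of "\<bar>a\<bar>"] mult_left_mono[OF b(2)[OF that], of "\<bar>b\<bar>"]
      abs_triangle_ineq[of "a * g s" "b * h s"]
    by (simp add: abs_mult)
  with m show ?thesis unfolding bfun_def by (auto intro!: exI[of _ "\<bar>a\<bar> * C + \<bar>b\<bar> * D"])
qed

lemma bfun_mult:
  assumes "g \<in> bfun" "h \<in> bfun"
  shows "(\<lambda>s. g s * h s) \<in> bfun"
proof -
  from assms obtain C D where m: "g \<in> borel_measurable M" "h \<in> borel_measurable M"
    and b: "\<And>s. s \<in> space M \<Longrightarrow> \<bar>g s\<bar> \<le> C" "\<And>s. s \<in> space M \<Longrightarrow> \<bar>h s\<bar> \<le> D"
    by (auto simp: bfun_def)
  have "\<bar>g s * h s\<bar> \<le> C * D" if "s \<in> space M" for s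
    unfolding abs_mult using b[OF that] by (intro mult_mono) auto
  with m show ?thesis unfolding bfun_def by auto
qed

lemma w_le_1:
  assumes "s \<in> space M" "e \<in> nbhd0"
  shows "w e s \<le> 1"
proof -
  have "w e s \<le> (\<Sum>e\<in>nbhd0. w e s)"
    by (rule member_le_sum[OF assms(2)]) (auto intro: w_nonneg[OF assms(1)] finite_nbhd0)
  then show ?thesis by (simp only: w_sum[OF assms(1)])
qed

lemma bfun_w [simp]:
  assumes "e \<in> nbhd0"
  shows "w e \<in> bfun"
proof -
  have "\<bar>w e s\<bar> \<le> 1" if "s \<in> space M" for s
    using w_nonneg[OF that, of e] w_le_1[OF that assms] by simp
  with w_measurable[OF assms] show ?thesis unfolding bfun_def by blast
qed

lemma bfun_integrable:
  assumes "g \<in> bfun" "prob_space N" "sets N = sets M"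
  shows "integrable N g"
proof -
  interpret prob_space N by fact
  from assms obtain C where m: "g \<in> borel_measurable M" and b: "\<And>s. s \<in> space M \<Longrightarrow> \<bar>g s\<bar> \<le> C"
    by (auto simp: bfun_def)
  show ?thesis
    using m b sets_eq_imp_space_eq[OF assms(3)]
    by (intro integrable_const_bound[of _ C]) (auto simp: measurable_cong_sets[OF assms(3) refl])
qed

lemma Kop_bfun [simp]:
  assumes "g \<in> bfun"
  shows "Kop g \<in> bfun"
proof -
  from assms obtain C where m[measurable]: "g \<in> borel_measurable M"
    and b: "\<And>s. s \<in> space M \<Longrightarrow> \<bar>g s\<bar> \<le> C"
    by (auto simp: bfun_def)
  note [measurable] = measurable_prob_algebraD[OF kernel]
  have "Kop g \<in> borel_measurable M" unfolding Kop_def[abs_def] by measurable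
  moreover have "\<bar>Kop g s\<bar> \<le> C" if s: "s \<in> space M" for s
  proof -
    interpret prob_space "K s" by (rule prob_K[OF s])
    have i: "integrable (K s) g" by (rule bfun_integrable[OF assms prob_K[OF s] sets_K[OF s]])
    have "\<bar>Kop g s\<bar> \<le> (\<integral>u. \<bar>g u\<bar> \<partial>K s)" unfolding Kop_def by (rule integral_abs_bound)
    also have "\<dots> \<le> (\<integral>u. C \<partial>K s)" using i b s by (intro integral_mono) (auto simp: space_K)
    finally show ?thesis by (simp add: prob_space)
  qed
  ultimately show ?thesis by (auto simp: bfun_def)
qed

lemma Kop_lin:
  assumes "g \<in> bfun" "h \<in> bfun" "s \<in> space M"
  shows "Kop (\<lambda>s. a * g s + b * h s) s = a * Kop g s + b * Kop h s"
  using assms bfun_integrable[OF _ prob_K[OF assms(3)] sets_K[OF assms(3)]]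
  by (simp add: Kop_def)

lemma Kop_const: "s \<in> space M \<Longrightarrow> Kop (\<lambda>_. c) s = c"
  using prob_space.prob_space[OF prob_K, of s] by (simp add: Kop_def)

lemma Kop_nonneg:
  assumes "\<And>s. s \<in> space M \<Longrightarrow> 0 \<le> g s" "s \<in> space M"
  shows "0 \<le> Kop g s"
  unfolding Kop_def using assms by (intro integral_nonneg_AE) (auto simp: space_K)

lemma stat_evolve:
  assumes "g \<in> bfun"
  shows "stat (Kop g) = stat g"
proof -
  from assms obtain C where m[measurable]: "g \<in> borel_measurable M"
    and b: "\<And>s. s \<in> space M \<Longrightarrow> norm (g s) \<le> C"
    by (auto simp: bfun_def)

  have ae: "AE s in \<pi>. emeasure (K s) (space (K s)) \<le> ennreal 1"
    by (rule AE_I2) (simp add: space_\<pi> prob_space.emeasure_space_1[OF prob_K])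
  have "stat g = (\<integral>s. g s \<partial>(\<pi> \<bind> K))" using stationary by (simp add: stat_def stationary_dist_def)
  also have "\<dots> = (\<integral>s. Kop g s \<partial>\<pi>)" unfolding Kop_def
    by (rule Giry_Monad.integral_bind[OF m _ _ _ ae])
      (use b measurable_prob_algebraD[OF kernel] prob_\<pi> in
        \<open>auto simp: measurable_cong_sets[OF sets_\<pi> refl] prob_space.finite_measure\<close>)
  finally show ?thesis by (simp add: stat_def)
qed

text \<open>The minorization on sets is the inequality \<kappa> \<pi> \<le> K s between measures;
  integrating a nonnegative function against both sides transfers it to functionals.\<close>

lemma Kop_minorization:
  assumes g: "g \<in> bfun" "\<And>s. s \<in> space M \<Longrightarrow> 0 \<le> g s" and s: "s \<in> space M"
  shows "\<kappa> * stat g \<le> Kop g s"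
proof -
  interpret P: prob_space \<pi> by (rule prob_\<pi>)
  interpret Q: prob_space "K s" by (rule prob_K[OF s])
  have [measurable]: "g \<in> borel_measurable M" using g by (simp add: bfun_def)
  have "scale_measure (ennreal \<kappa>) \<pi> \<le> K s"
    using minorization[OF s] \<kappa>
    by (subst le_measure)
      (auto simp: sets_K[OF s] sets_\<pi> P.emeasure_eq_measure Q.emeasure_eq_measure ennreal_mult[symmetric])
  then have "(\<integral>\<^sup>+u. g u \<partial>scale_measure (ennreal \<kappa>) \<pi>) \<le> (\<integral>\<^sup>+u. g u \<partial>K s)"
    by (intro nn_integral_mono_measure) (simp_all add: sets_K[OF s] sets_\<pi>)
  also have "(\<integral>\<^sup>+u. g u \<partial>scale_measure (ennreal \<kappa>) \<pi>) = ennreal \<kappa> * (\<integral>\<^sup>+u. g u \<partial>\<pi>)"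
    by (rule nn_integral_scale_measure) measurable
  also have "(\<integral>\<^sup>+u. g u \<partial>\<pi>) = ennreal (stat g)" unfolding stat_def
    using g by (intro nn_integral_eq_integral bfun_integrable prob_\<pi> sets_\<pi>) (auto simp: space_\<pi>)
  also have "(\<integral>\<^sup>+u. g u \<partial>K s) = ennreal (Kop g s)" unfolding Kop_def
    using g s by (intro nn_integral_eq_integral bfun_integrable prob_K sets_K) (auto simp: space_K)
  finally have "ennreal (\<kappa> * stat g) \<le> ennreal (Kop g s)" using \<kappa> by (simp add: ennreal_mult')
  then show ?thesis using Kop_nonneg[OF g(2) s] by (simp add: ennreal_le_iff)
qed

section \<open>States as normalized positive functionals\<close>

lemma stateD:
  assumes "is_state L"
  shows state_lin: "g \<in> bfun \<Longrightarrow> h \<in> bfun \<Longrightarrow> L (\<lambda>s. a * g s + b * h s) = a * L g + b * L h"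
    and state_nonneg: "g \<in> bfun \<Longrightarrow> (\<And>s. s \<in> space M \<Longrightarrow> 0 \<le> g s) \<Longrightarrow> 0 \<le> L g"
    and state_1: "L (\<lambda>_. 1) = 1"
  using assms by (auto simp: is_state_def)

lemma state_const: "is_state L \<Longrightarrow> L (\<lambda>_. c) = c"
  using state_lin[of L "\<lambda>_. 1" "\<lambda>_. 1" c 0] by (simp add: state_1)

lemma state_mono:
  assumes L: "is_state L" and "g \<in> bfun" "h \<in> bfun" "\<And>s. s \<in> space M \<Longrightarrow> g s \<le> h s"
  shows "L g \<le> L h"
proof -
  have "0 \<le> L (\<lambda>s. 1 * h s + (- 1) * g s)"
    using assms by (intro state_nonneg[OF L] bfun_lin) auto
  also have "\<dots> = 1 * L h + (- 1) * L g" by (intro state_lin[OF L] assms)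
  finally show ?thesis by simp
qed

lemma state_cong:
  assumes L: "is_state L" and "g \<in> bfun" "h \<in> bfun" "\<And>s. s \<in> space M \<Longrightarrow> g s = h s"
  shows "L g = L h"
  using assms by (intro antisym state_mono[OF L]) auto

lemma state_sum:
  assumes L: "is_state L" and "finite J" and "\<And>j. j \<in> J \<Longrightarrow> f j \<in> bfun"
  shows "(\<lambda>s. \<Sum>j\<in>J. f j s) \<in> bfun \<and> L (\<lambda>s. \<Sum>j\<in>J. f j s) = (\<Sum>j\<in>J. L (f j))"
  using assms(2,3)
proof (induction J rule: finite_induct)
  case (insert j J)
  then have "f j \<in> bfun" "(\<lambda>s. \<Sum>j\<in>J. f j s) \<in> bfun" by auto
  from bfun_lin[OF this, of 1 1] state_lin[OF L this, of 1 1] insert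
  show ?case by simp
qed (simp add: state_const[OF L])

lemma state_stat: "is_state stat"
  unfolding is_state_def
proof (intro conjI ballI allI impI)
  fix g h a b assume "g \<in> bfun" "h \<in> bfun"
  then show "stat (\<lambda>s. a * g s + b * h s) = a * stat g + b * stat h"
    using bfun_integrable[OF _ prob_\<pi> sets_\<pi>] by (simp add: stat_def)
next
  fix g :: "'s \<Rightarrow> real" assume "\<forall>s\<in>space M. 0 \<le> g s"
  then show "0 \<le> stat g" by (auto simp: stat_def space_\<pi> intro!: integral_nonneg_AE)
qed (use prob_space.prob_space[OF prob_\<pi>] in \<open>simp add: stat_def\<close>)

lemma state_evolve:
  assumes L: "is_state L"
  shows "is_state (evolve L)"
  unfolding is_state_def
proof (intro conjI ballI allI impI)
  fix g h a b assume gh: "g \<in> bfun" "h \<in> bfun"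
  have "L (Kop (\<lambda>s. a * g s + b * h s)) = L (\<lambda>s. a * Kop g s + b * Kop h s)"
    using gh by (intro state_cong[OF L] Kop_bfun bfun_lin) (auto simp: Kop_lin)
  then show "evolve L (\<lambda>s. a * g s + b * h s) = a * evolve L g + b * evolve L h"
    using gh by (simp add: evolve_def state_lin[OF L])
next
  fix g assume "g \<in> bfun" "\<forall>s\<in>space M. 0 \<le> g s"
  then show "0 \<le> evolve L g"
    unfolding evolve_def by (intro state_nonneg[OF L] Kop_bfun Kop_nonneg) auto
next
  have "L (Kop (\<lambda>_. 1)) = L (\<lambda>_. 1)" by (intro state_cong[OF L]) (auto simp: Kop_const)
  then show "evolve L (\<lambda>_. 1) = 1" by (simp add: evolve_def state_1[OF L])
qed

lemma state_w_nonneg: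
  assumes "is_state L" "e \<in> nbhd0"
  shows "0 \<le> L (w e)"
  by (rule state_nonneg[OF assms(1) bfun_w[OF assms(2)]]) (rule w_nonneg)

lemma state_w_sum:
  assumes L: "is_state L"
  shows "(\<Sum>e\<in>nbhd0. L (w e)) = 1"
proof -
  have s: "(\<lambda>s. \<Sum>e\<in>nbhd0. w e s) \<in> bfun \<and> L (\<lambda>s. \<Sum>e\<in>nbhd0. w e s) = (\<Sum>e\<in>nbhd0. L (w e))"
    by (rule state_sum[OF L finite_nbhd0 bfun_w])
  have "L (\<lambda>s. \<Sum>e\<in>nbhd0. w e s) = L (\<lambda>_. 1)"
    by (rule state_cong[OF L]) (use s w_sum in auto)
  then show ?thesis using s state_1[OF L] by metis
qed

text \<open>Bayes' rule without division, so that jumps of probability zero need no separate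
  treatment later: if \<open>L (w e) = 0\<close>, then |w e g| \<le> C w e and positivity force the
  right-hand side to vanish.\<close>

lemma cond_mult:
  assumes L: "is_state L" and e: "e \<in> nbhd0" and g: "g \<in> bfun"
  shows "L (w e) * cond e L g = L (\<lambda>s. w e s * g s)"
proof (cases "L (w e) = 0")
  case True
  from g obtain C where C: "\<And>s. s \<in> space M \<Longrightarrow> \<bar>g s\<bar> \<le> C" by (auto simp: bfun_def)
  have b: "(\<lambda>s. w e s * g s) \<in> bfun" using e g by (simp add: bfun_mult)
  \<comment> \<open>The zero summand brings the multiple of \<open>w e\<close> into the two-term
    form in which linearity of states is stated.\<close>
  have 1: "(\<lambda>s. D * w e s + 0 * w e s) \<in> bfun" for D using e by (intro bfun_lin) auto
  have le: "\<bar>w e s * g s\<bar> \<le> C * w e s" if "s \<in> space M" for s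
    using mult_left_mono[OF C[OF that] w_nonneg[OF that, of e]] w_nonneg[OF that, of e]
    by (simp add: abs_mult mult.commute)
  have "L (\<lambda>s. w e s * g s) \<le> L (\<lambda>s. C * w e s + 0 * w e s)"
    using le by (intro state_mono[OF L b 1]) (auto simp: abs_le_iff)
  moreover have "L (\<lambda>s. (- C) * w e s + 0 * w e s) \<le> L (\<lambda>s. w e s * g s)"
  proof (rule state_mono[OF L 1 b])
    fix s assume "s \<in> space M"
    from le[OF this] show "(- C) * w e s + 0 * w e s \<le> w e s * g s" by (simp add: abs_le_iff)
  qed
  moreover have "L (\<lambda>s. D * w e s + 0 * w e s) = 0" for D
    using state_lin[OF L, of "w e" "w e" D 0] e True by simp
  ultimately have "L (\<lambda>s. w e s * g s) = 0" by (metis antisym)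
  with True show ?thesis by simp
qed (simp add: cond_def)

lemma state_cond:
  assumes L: "is_state L" and e: "e \<in> nbhd0"
  shows "is_state (cond e L)"
proof (cases "L (w e) = 0")
  case True
  then have "cond e L = stat" by (simp add: cond_def fun_eq_iff)
  then show ?thesis by (simp add: state_stat)
next
  case False
  then have pos: "0 < L (w e)" using state_w_nonneg[OF L e] by simp
  show ?thesis unfolding is_state_def
  proof (intro conjI ballI allI impI)
    fix g h a b assume gh: "g \<in> bfun" "h \<in> bfun"
    then have wg: "(\<lambda>s. w e s * g s) \<in> bfun" "(\<lambda>s. w e s * h s) \<in> bfun"
      using e by (auto intro: bfun_mult)
    have "(\<lambda>s. w e s * (a * g s + b * h s)) = (\<lambda>s. a * (w e s * g s) + b * (w e s * h s))"
      by (auto simp: algebra_simps)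
    then show "cond e L (\<lambda>s. a * g s + b * h s) = a * cond e L g + b * cond e L h"
      using False state_lin[OF L wg, of a b] by (simp add: cond_def add_divide_distrib)
  next
    fix g assume "g \<in> bfun" "\<forall>s\<in>space M. 0 \<le> g s"
    then have "0 \<le> L (\<lambda>s. w e s * g s)"
      using e by (intro state_nonneg[OF L] bfun_mult) (simp_all add: w_nonneg)
    with pos show "0 \<le> cond e L g" by (simp add: cond_def)
  next
    show "cond e L (\<lambda>_. 1) = 1" using False by (auto simp: cond_def)
  qed
qed

text \<open>The remainder (\<open>evolve L\<close> - \<kappa> \<open>stat\<close>) / (1 - \<kappa>)
  is positive by the minorization and normalized by linearity. For \<kappa> = 1 it degenerates to
  0/0; there the domination itself forces \<open>evolve L = stat\<close> on
  \<open>bfun\<close>.\<close>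

lemma evolve_decomp:
  assumes L: "is_state L"
  shows "\<exists>\<nu>. is_state \<nu> \<and> (\<forall>g\<in>bfun. evolve L g = \<kappa> * stat g + (1 - \<kappa>) * \<nu> g)"
proof -
  have E: "is_state (evolve L)" by (rule state_evolve[OF L])
  have ge: "\<kappa> * stat g \<le> evolve L g" if "g \<in> bfun" "\<And>s. s \<in> space M \<Longrightarrow> 0 \<le> g s" for g
  proof -
    have "\<kappa> * stat g = L (\<lambda>_. \<kappa> * stat g)" by (simp add: state_const[OF L])
    also have "\<dots> \<le> L (Kop g)" using that by (intro state_mono[OF L]) (auto intro: Kop_minorization)
    finally show ?thesis by (simp add: evolve_def)
  qed
  show ?thesis
  proof (cases "\<kappa> = 1")
    case True
    have "evolve L g = stat g" if g: "g \<in> bfun" for g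
    proof -
      from g obtain C where C: "\<And>s. s \<in> space M \<Longrightarrow> \<bar>g s\<bar> \<le> C" by (auto simp: bfun_def)
      \<comment> \<open>Domination holds for nonnegative functions only; applied to C + g and C - g
        it gives both inequalities.\<close>
      have "C * 1 + d * stat g \<le> C * 1 + d * evolve L g" if d: "d = 1 \<or> d = - 1" for d
      proof -
        have "\<kappa> * stat (\<lambda>s. C * 1 + d * g s) \<le> evolve L (\<lambda>s. C * 1 + d * g s)"
        proof (rule ge)
          show "(\<lambda>s. C * 1 + d * g s) \<in> bfun" using g by (intro bfun_lin) auto
          show "0 \<le> C * 1 + d * g s" if "s \<in> space M" for s
            using C[OF that] d by (auto simp: abs_le_iff)
        qed
        also have "stat (\<lambda>s. C * 1 + d * g s) = C * 1 + d * stat g"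
          using state_lin[OF state_stat bfun_const[of 1] g, of C d] by (simp only: state_1[OF state_stat])
        also have "evolve L (\<lambda>s. C * 1 + d * g s) = C * 1 + d * evolve L g"
          using state_lin[OF E bfun_const[of 1] g, of C d] by (simp only: state_1[OF E])
        finally show ?thesis by (simp only: True mult_1)
      qed
      from this[of 1] this[of "-1"] show ?thesis by linarith
    qed
    then show ?thesis using True state_stat by auto
  next
    case False
    then have \<kappa>1: "0 < 1 - \<kappa>" using \<kappa> by simp
    define \<nu> where "\<nu> g = (evolve L g - \<kappa> * stat g) / (1 - \<kappa>)" for g
    have "is_state \<nu>" unfolding is_state_def
    proof (intro conjI ballI allI impI)
      fix g h a b assume gh: "g \<in> bfun" "h \<in> bfun"
      have "evolve L (\<lambda>s. a * g s + b * h s) - \<kappa> * stat (\<lambda>s. a * g s + b * h s)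
        = a * (evolve L g - \<kappa> * stat g) + b * (evolve L h - \<kappa> * stat h)"
        using state_lin[OF E gh] state_lin[OF state_stat gh] by (simp add: algebra_simps)
      then show "\<nu> (\<lambda>s. a * g s + b * h s) = a * \<nu> g + b * \<nu> h"
        by (simp add: \<nu>_def add_divide_distrib)
    next
      fix g assume "g \<in> bfun" "\<forall>s\<in>space M. 0 \<le> g s"
      then show "0 \<le> \<nu> g" using ge[of g] \<kappa>1 by (simp add: \<nu>_def)
    qed (use \<kappa>1 state_1[OF E] state_1[OF state_stat] in \<open>simp add: \<nu>_def\<close>)
    moreover have "evolve L g = \<kappa> * stat g + (1 - \<kappa>) * \<nu> g" for g
      using \<kappa>1 by (simp add: \<nu>_def)
    ultimately show ?thesis by blast
  qed
qed

end

section \<open>The walk under the annealed law\<close>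

text \<open>A box in the supremum norm: a jump changes each coordinate by at most one, so n steps
  stay inside it, and its cardinality is polynomial in n.\<close>

definition near :: "nat \<Rightarrow> int ^ 'd::finite \<Rightarrow> int ^ 'd \<Rightarrow> bool" where
  "near n x y \<longleftrightarrow> (\<forall>i. \<bar>y $ i - x $ i\<bar> \<le> int n)"

lemma near_refl [simp]: "near n x x"
  by (simp add: near_def)

lemma nbhd0_component:
  assumes "e \<in> nbhd0"
  shows "\<bar>e $ i\<bar> \<le> 1"
  using assms by (auto simp: nbhd0_def axis_def)

lemma near_step:
  assumes "e \<in> nbhd0" "near n (x + e) y"
  shows "near (Suc n) x y"
  unfolding near_def
proof
  fix i
  have "\<bar>y $ i - (x $ i + e $ i)\<bar> \<le> int n" "\<bar>e $ i\<bar> \<le> 1"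
    using assms nbhd0_component by (auto simp: near_def)
  then show "\<bar>y $ i - x $ i\<bar> \<le> int (Suc n)" by linarith
qed

lemma finite_near: "finite {y. near n x y}"
  and card_near_le: "card {y. near n x (y :: int ^ 'd::finite)} \<le> (2 * n + 1) ^ CARD('d)"
proof -
  let ?P = "PiE (UNIV :: 'd set) (\<lambda>i. {x $ i - int n .. x $ i + int n})"
  have fin: "finite ?P" by (intro finite_PiE) auto
  have sub: "{y. near n x y} \<subseteq> vec_lambda ` ?P"
  proof
    fix y assume y: "y \<in> {y. near n x y}"
    have "y $ i \<in> {x $ i - int n .. x $ i + int n}" for i
      using y by (auto simp: near_def abs_le_iff dest!: spec[of _ i])
    then show "y \<in> vec_lambda ` ?P" by (intro image_eqI[of _ _ "vec_nth y"]) auto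
  qed
  show "finite {y. near n x y}" by (rule finite_subset[OF sub]) (use fin in auto)
  have "card {y. near n x y} \<le> card (vec_lambda ` ?P)" using fin by (intro card_mono sub) auto
  also have "\<dots> \<le> card ?P" by (rule card_image_le[OF fin])
  also have "\<dots> = (2 * n + 1) ^ CARD('d)"
  proof -
    have "nat (2 * int n + 1) = 2 * n + 1" by linarith
    then show ?thesis by (simp add: card_PiE algebra_simps)
  qed
  finally show "card {y. near n x y} \<le> (2 * n + 1) ^ CARD('d)" .
qed

context minorized_environment
begin

text \<open>The transition operator of the Markov chain formed by the conditional law \<open>L\<close> of the environment
  given the past path and the position \<open>x\<close>; it is a finite sum over jumps.\<close>

definition Pop where
  "Pop F L x = (\<Sum>e\<in>nbhd0. L x (w e) * F (step L x e) (x + e :: int ^ 'd) :: real)"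

definition fam :: "(int ^ 'd \<Rightarrow> 's state) \<Rightarrow> bool" where
  "fam L \<longleftrightarrow> (\<forall>y. is_state (L y))"

lemma famD: "fam L \<Longrightarrow> is_state (L y)"
  by (simp add: fam_def)

lemma fam_stat: "fam (\<lambda>_. stat)"
  by (simp add: fam_def state_stat)

lemma fam_step: "fam L \<Longrightarrow> e \<in> nbhd0 \<Longrightarrow> fam (step L x e)"
  by (simp add: fam_def step_def state_evolve state_cond)

lemma Pop_Suc: "(Pop ^^ Suc n) F L x = (\<Sum>e\<in>nbhd0. L x (w e) * (Pop ^^ n) F (step L x e) (x + e))"
  by (simp add: Pop_def)

text \<open>The jump weights are nonnegative. Restricting the comparison to positions within reach
  is what later permits bounds on the displacement over one block.\<close>

lemma Pop_pow_mono:
  assumes "fam L" "\<And>L' x'. fam L' \<Longrightarrow> near n x x' \<Longrightarrow> F L' x' \<le> G L' x'"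
  shows "(Pop ^^ n) F L x \<le> (Pop ^^ n) G L x"
  using assms
proof (induction n arbitrary: L x)
  case (Suc n)
  show ?case unfolding Pop_Suc
  proof (intro sum_mono mult_left_mono)
    fix e assume e: "e \<in> (nbhd0 :: (int ^ 'd) set)"
    show "0 \<le> L x (w e)" by (rule state_w_nonneg[OF famD[OF Suc.prems(1)] e])
    show "(Pop ^^ n) F (step L x e) (x + e) \<le> (Pop ^^ n) G (step L x e) (x + e)"
      by (rule Suc.IH[OF fam_step[OF Suc.prems(1) e]]) (rule Suc.prems(2)[OF _ near_step[OF e]])
  qed
qed auto

lemma Pop_pow_lin:
  "(Pop ^^ n) (\<lambda>L x. a * F L x + b * G L x) L x = a * (Pop ^^ n) F L x + b * (Pop ^^ n) G L x"
  by (induction n arbitrary: L x)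
    (simp_all only: Pop_Suc sum_distrib_left sum.distrib[symmetric] funpow_0, simp add: algebra_simps)

lemma Pop_pow_const:
  assumes "fam L"
  shows "(Pop ^^ n) (\<lambda>_ _. c) L x = c"
  using assms
proof (induction n arbitrary: L x)
  case (Suc n)
  have "(Pop ^^ Suc n) (\<lambda>_ _. c) L x = (\<Sum>e\<in>nbhd0. L x (w e) * c)"
    unfolding Pop_Suc by (intro sum.cong refl) (simp add: Suc.IH fam_step Suc.prems)
  also have "\<dots> = (\<Sum>e\<in>nbhd0. L x (w e)) * c" by (rule sum_distrib_right[symmetric])
  finally show ?case by (simp add: state_w_sum famD Suc.prems)
qed simp

text \<open>In n steps the walk consults only sites of the box. Far sites may therefore be replaced
  by stationary ones, which leaves finitely many non-stationary sites whatever the initial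
  family.\<close>

lemma Pop_local:
  assumes "\<And>y g. near n x y \<Longrightarrow> g \<in> bfun \<Longrightarrow> L y g = L' y g"
  shows "(Pop ^^ n) (\<lambda>_. h) L x = (Pop ^^ n) (\<lambda>_. h) L' x"
  using assms
proof (induction n arbitrary: L L' x)
  case (Suc n)
  show ?case unfolding Pop_Suc
  proof (intro sum.cong refl arg_cong2[where f="(*)"])
    fix e assume e: "e \<in> (nbhd0 :: (int ^ 'd) set)"
    show "L x (w e) = L' x (w e)" by (intro Suc.prems) (simp_all add: e)
    show "(Pop ^^ n) (\<lambda>_. h) (step L x e) (x + e) = (Pop ^^ n) (\<lambda>_. h) (step L' x e) (x + e)"
    proof (rule Suc.IH)
      fix y g assume y: "near n (x + e) y" and g: "g \<in> bfun"
      \<comment> \<open>The site just left has been conditioned and evolved, so its new law tests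
        the old one on this product.\<close>
      have b: "(\<lambda>s. w e s * Kop g s) \<in> bfun" using e g by (intro bfun_mult) auto
      show "step L x e y g = step L' x e y g"
        using Suc.prems[OF near_step[OF e y] Kop_bfun[OF g]] Suc.prems[OF near_refl b]
          Suc.prems[OF near_refl bfun_w[OF e]]
        by (auto simp: step_def evolve_def cond_def)
    qed
  qed
qed simp

lemma Pop_shift:
  "(Pop ^^ n) (\<lambda>_ x. h (x + z)) (\<lambda>y. L (y + z)) x = (Pop ^^ n) (\<lambda>_. h) L (x + z)"
proof (induction n arbitrary: L x)
  case (Suc n)
  have "step (\<lambda>y. L (y + z)) x e = (\<lambda>y. step L (x + z) e (y + z))" for e
    by (auto simp: step_def)
  then show ?case by (simp only: Pop_Suc Suc.IH add.assoc add.commute[of z])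
qed simp

text \<open>Conditioning is not affine, but the probability of the jump times the conditioned law
  is. A mixture with weight \<theta> becomes one with the posterior weight \<theta>', and the
  prefactor \<open>L x (w e)\<close> cancels its denominator. The weight changes at each visit to
  \<open>y\<close>, hence the induction over arbitrary \<theta>.\<close>

lemma Pop_affine:
  assumes "fam L" "is_state \<mu>" "is_state \<mu>1" "is_state \<mu>2" "0 \<le> \<theta>" "\<theta> \<le> 1"
    and "\<And>g. g \<in> bfun \<Longrightarrow> \<mu> g = \<theta> * \<mu>1 g + (1 - \<theta>) * \<mu>2 g"
  shows "(Pop ^^ n) (\<lambda>_. h) (L(y := \<mu>)) x
    = \<theta> * (Pop ^^ n) (\<lambda>_. h) (L(y := \<mu>1)) x + (1 - \<theta>) * (Pop ^^ n) (\<lambda>_. h) (L(y := \<mu>2)) x"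
  using assms
proof (induction n arbitrary: L \<mu> \<mu>1 \<mu>2 \<theta> x)
  case 0
  then show ?case by (simp add: algebra_simps)
next
  case (Suc n)
  let ?P = "(Pop ^^ n) (\<lambda>_. h)"
  note mix = Suc.prems(7)
  have "(L(y := \<mu>)) x (w e) * ?P (step (L(y := \<mu>)) x e) (x + e)
     = \<theta> * ((L(y := \<mu>1)) x (w e) * ?P (step (L(y := \<mu>1)) x e) (x + e))
       + (1 - \<theta>) * ((L(y := \<mu>2)) x (w e) * ?P (step (L(y := \<mu>2)) x e) (x + e))"
    if e: "e \<in> nbhd0" for e
  proof (cases "x = y")
    case False
    have "step (L(y := \<rho>)) x e = (step L x e)(y := evolve \<rho>)" for \<rho>
      using False by (auto simp: step_def)
    moreover have "?P ((step L x e)(y := evolve \<mu>)) (x + e)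
       = \<theta> * ?P ((step L x e)(y := evolve \<mu>1)) (x + e) + (1 - \<theta>) * ?P ((step L x e)(y := evolve \<mu>2)) (x + e)"
    proof (rule Suc.IH)
      show "evolve \<mu> g = \<theta> * evolve \<mu>1 g + (1 - \<theta>) * evolve \<mu>2 g" if "g \<in> bfun" for g
        unfolding evolve_def by (rule mix[OF Kop_bfun[OF that]])
    qed (use Suc.prems e in \<open>auto intro: fam_step state_evolve\<close>)
    moreover have "p * (\<theta> * A + (1 - \<theta>) * B) = \<theta> * (p * A) + (1 - \<theta>) * (p * B)" for p A B :: real
      by (simp add: algebra_simps)
    ultimately show ?thesis using False by (simp only: fun_upd_apply if_False)
  next
    case True
    have st: "step (L(y := \<rho>)) x e = (step L x e)(y := evolve (cond e \<rho>))" for \<rho>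
      using True by (auto simp: step_def)
    let ?p = "\<mu> (w e)" and ?p1 = "\<mu>1 (w e)" and ?p2 = "\<mu>2 (w e)"
    have p: "?p = \<theta> * ?p1 + (1 - \<theta>) * ?p2" by (rule mix[OF bfun_w[OF e]])
    have nn: "0 \<le> \<theta> * ?p1" "0 \<le> (1 - \<theta>) * ?p2"
      using Suc.prems state_w_nonneg[OF _ e] by auto
    show ?thesis
    proof (cases "?p = 0")
      case True
      \<comment> \<open>A jump impossible under the mixture has weight zero in both parts, so the
        values after it are irrelevant.\<close>
      with p nn have z: "\<theta> * ?p1 = 0" "(1 - \<theta>) * ?p2 = 0" by linarith+
      have "\<theta> * (?p1 * A) = (\<theta> * ?p1) * A" "(1 - \<theta>) * (?p2 * A) = ((1 - \<theta>) * ?p2) * A" for A by simp_all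
      with z True show ?thesis by (simp only: \<open>x = y\<close> fun_upd_same mult_zero_left)
    next
      case False
      with p nn have pos: "0 < ?p" by linarith
      \<comment> \<open>Posterior probability of the first component given the jump
        \<open>e\<close>.\<close>
      define \<theta>' where "\<theta>' = \<theta> * ?p1 / ?p"
      have p1: "?p * \<theta>' = \<theta> * ?p1" using pos by (simp add: \<theta>'_def)
      have "?p * (1 - \<theta>') = ?p - \<theta> * ?p1" by (simp only: right_diff_distrib p1 mult_1_right)
      then have p2: "?p * (1 - \<theta>') = (1 - \<theta>) * ?p2" using p by linarith
      have "0 \<le> \<theta>'" using nn pos by (simp add: \<theta>'_def)
      moreover have "\<theta>' \<le> 1" unfolding \<theta>'_def using p nn pos by (subst divide_le_eq_1_pos) linarith+
      ultimately have \<theta>': "0 \<le> \<theta>'" "\<theta>' \<le> 1" "?p * \<theta>' = \<theta> * ?p1" "?p * (1 - \<theta>') = (1 - \<theta>) * ?p2"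
        using p1 p2 by auto
      have "?P ((step L x e)(y := evolve (cond e \<mu>))) (x + e)
         = \<theta>' * ?P ((step L x e)(y := evolve (cond e \<mu>1))) (x + e)
           + (1 - \<theta>') * ?P ((step L x e)(y := evolve (cond e \<mu>2))) (x + e)"
      proof (rule Suc.IH)
        fix g assume g: "g \<in> bfun"
        then have b: "(\<lambda>s. w e s * Kop g s) \<in> bfun" using e by (intro bfun_mult) auto
        have "?p * evolve (cond e \<mu>) g = \<mu> (\<lambda>s. w e s * Kop g s)"
          unfolding evolve_def by (rule cond_mult[OF Suc.prems(2) e Kop_bfun[OF g]])
        also have "\<dots> = \<theta> * \<mu>1 (\<lambda>s. w e s * Kop g s) + (1 - \<theta>) * \<mu>2 (\<lambda>s. w e s * Kop g s)"
          by (rule mix[OF b])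
        also have "\<dots> = \<theta> * (?p1 * evolve (cond e \<mu>1) g) + (1 - \<theta>) * (?p2 * evolve (cond e \<mu>2) g)"
          unfolding evolve_def
          by (simp only: cond_mult[OF Suc.prems(3) e Kop_bfun[OF g]] cond_mult[OF Suc.prems(4) e Kop_bfun[OF g]])
        also have "\<dots> = (\<theta> * ?p1) * evolve (cond e \<mu>1) g + ((1 - \<theta>) * ?p2) * evolve (cond e \<mu>2) g"
          by (simp only: mult.assoc)
        also have "\<dots> = ?p * (\<theta>' * evolve (cond e \<mu>1) g + (1 - \<theta>') * evolve (cond e \<mu>2) g)"
          unfolding \<theta>'(3,4)[symmetric] by (simp only: mult.assoc distrib_left)
        finally show "evolve (cond e \<mu>) g = \<theta>' * evolve (cond e \<mu>1) g + (1 - \<theta>') * evolve (cond e \<mu>2) g"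
          using pos by (simp only: mult_cancel_left) simp
      qed (use Suc.prems e \<theta>' in \<open>auto intro: fam_step state_evolve state_cond\<close>)
      then have "?p * ?P ((step L x e)(y := evolve (cond e \<mu>))) (x + e)
         = (?p * \<theta>') * ?P ((step L x e)(y := evolve (cond e \<mu>1))) (x + e)
           + (?p * (1 - \<theta>')) * ?P ((step L x e)(y := evolve (cond e \<mu>2))) (x + e)"
        by (simp only: mult.assoc distrib_left)
      then show ?thesis unfolding st \<theta>'(3,4) by (simp only: \<open>x = y\<close> fun_upd_same mult.assoc)
    qed
  qed
  then show ?case by (simp only: Pop_Suc sum_distrib_left sum.distrib[symmetric] cong: sum.cong)
qed

section \<open>Mean displacement and the number of non-stationary sites\<close>

definition disp :: "'d \<Rightarrow> nat \<Rightarrow> (int ^ 'd \<Rightarrow> 's state) \<Rightarrow> int ^ 'd \<Rightarrow> real" where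
  "disp i n L x = (Pop ^^ n) (\<lambda>_ x. real_of_int (x $ i)) L x - real_of_int (x $ i)"

definition \<beta> :: "'d \<Rightarrow> nat \<Rightarrow> real" where
  "\<beta> i n = disp i n (\<lambda>_. stat) 0"

text \<open>\<open>k\<close> bounds the number of sites whose law may differ from
  \<open>stat\<close>; the inequality \<open>card U \<le> k\<close> allows \<open>U\<close> to
  contain sites that are in fact stationary.\<close>

definition fresh :: "nat \<Rightarrow> (int ^ 'd \<Rightarrow> 's state) \<Rightarrow> bool" where
  "fresh k L \<longleftrightarrow> (\<exists>U. finite U \<and> card U \<le> k \<and> (\<forall>y g. y \<notin> U \<longrightarrow> g \<in> bfun \<longrightarrow> L y g = stat g))"

lemma disp_stat: "disp i n (\<lambda>_. stat) x = \<beta> i n"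
proof -
  have "(Pop ^^ n) (\<lambda>_ y. real_of_int (y $ i)) (\<lambda>_. stat) (0 + x)
    = (Pop ^^ n) (\<lambda>L y. 1 * real_of_int (y $ i) + real_of_int (x $ i) * 1) (\<lambda>_. stat) 0"
    unfolding Pop_shift[symmetric] by simp
  also have "\<dots> = (Pop ^^ n) (\<lambda>L y. real_of_int (y $ i)) (\<lambda>_. stat) 0 + real_of_int (x $ i)"
    using Pop_pow_lin[of n 1 "\<lambda>_ y. real_of_int (y $ i)" "real_of_int (x $ i)" "\<lambda>_ _. 1" "\<lambda>_. stat" 0]
    by (simp only: Pop_pow_const[OF fam_stat] mult_1 mult_1_right)
  finally show ?thesis by (simp add: disp_def \<beta>_def)
qed

lemma disp_fresh_0:
  assumes "fresh 0 L"
  shows "disp i n L x = \<beta> i n"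
proof -
  have "(Pop ^^ n) (\<lambda>_ x. real_of_int (x $ i)) L x = (Pop ^^ n) (\<lambda>_ x. real_of_int (x $ i)) (\<lambda>_. stat) x"
    using assms by (intro Pop_local) (auto simp: fresh_def)
  then have "disp i n L x = disp i n (\<lambda>_. stat) x" by (simp add: disp_def)
  then show ?thesis by (simp add: disp_stat)
qed

lemma disp_Suc:
  assumes L: "fam L"
  shows "disp i (Suc n) L x = (\<Sum>e\<in>nbhd0. L x (w e) * (real_of_int (e $ i) + disp i n (step L x e) (x + e)))"
proof -
  have "(\<Sum>e\<in>nbhd0. L x (w e) * (real_of_int (e $ i) + disp i n (step L x e) (x + e)))
    = (\<Sum>e\<in>nbhd0. L x (w e) * (Pop ^^ n) (\<lambda>_ x. real_of_int (x $ i)) (step L x e) (x + e))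
      - (\<Sum>e\<in>nbhd0. L x (w e)) * real_of_int (x $ i)"
    unfolding sum_distrib_right sum_subtractf[symmetric]
    by (intro sum.cong refl) (simp add: disp_def algebra_simps)
  also have "\<dots> = disp i (Suc n) L x"
    by (simp only: disp_def Pop_Suc state_w_sum[OF famD[OF L]] mult_1)
  finally show ?thesis by simp
qed

lemma convex_sum_bound:
  assumes L: "is_state L" and "\<And>e. e \<in> nbhd0 \<Longrightarrow> \<bar>f e - b\<bar> \<le> c"
  shows "\<bar>(\<Sum>e\<in>nbhd0. L (w e) * f e) - b\<bar> \<le> c"
proof -
  have s: "(\<Sum>e\<in>nbhd0. L (w e)) = 1" by (rule state_w_sum[OF L])
  have "(\<Sum>e\<in>nbhd0. L (w e) * f e) - b = (\<Sum>e\<in>nbhd0. L (w e) * f e) - (\<Sum>e\<in>nbhd0. L (w e)) * b"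
    by (simp add: s)
  also have "\<dots> = (\<Sum>e\<in>nbhd0. L (w e) * (f e - b))"
    by (simp add: sum_distrib_right sum_subtractf right_diff_distrib)
  also have "\<bar>\<dots>\<bar> \<le> (\<Sum>e\<in>nbhd0. L (w e) * c)"
  proof (rule order_trans[OF sum_abs], rule sum_mono)
    fix e assume e: "e \<in> (nbhd0 :: (int ^ 'd) set)"
    show "\<bar>L (w e) * (f e - b)\<bar> \<le> L (w e) * c"
      using mult_left_mono[OF assms(2)[OF e] state_w_nonneg[OF L e]] state_w_nonneg[OF L e]
      by (simp add: abs_mult)
  qed
  also have "\<dots> = c" by (simp add: sum_distrib_right[symmetric] s)
  finally show ?thesis .
qed

text \<open>With the additional step placed last, it averages jumps of size at most one over the
  state reached after n steps.\<close>

lemma disp_increment: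
  assumes "fam L"
  shows "\<bar>disp i (Suc n) L x - disp i n L x\<bar> \<le> 1"
proof -
  let ?X = "\<lambda>_ x. real_of_int (x $ i)"
  have b: "\<bar>Pop ?X L' x' - ?X L' x'\<bar> \<le> 1" if "fam L'" for L' x'
    unfolding Pop_def
  proof (rule convex_sum_bound[OF famD[OF that]])
    fix e assume e: "e \<in> (nbhd0 :: (int ^ 'd) set)"
    show "\<bar>real_of_int ((x' + e) $ i) - real_of_int (x' $ i)\<bar> \<le> 1"
      using nbhd0_component[OF e, of i] by simp
  qed
  have "(Pop ^^ Suc n) ?X L x = (Pop ^^ n) (Pop ?X) L x"
    by (simp add: funpow_swap1)
  moreover have "(Pop ^^ n) (Pop ?X) L x \<le> (Pop ^^ n) (\<lambda>L x. 1 * ?X L x + 1 * 1) L x"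
    using b by (intro Pop_pow_mono assms) (auto simp: abs_le_iff algebra_simps)
  moreover have "(Pop ^^ n) (\<lambda>L x. 1 * ?X L x + (-1) * 1) L x \<le> (Pop ^^ n) (Pop ?X) L x"
    using b by (intro Pop_pow_mono assms) (auto simp: abs_le_iff algebra_simps)
  ultimately show ?thesis
    unfolding Pop_pow_lin[of n _ _ _ "\<lambda>_ _. 1"] Pop_pow_const[OF assms] disp_def by linarith
qed

text \<open>The sites of \<open>V\<close> are refreshed independently with probability \<open>\<kappa>\<close>, so that a binomial number
  of them stays non-stationary; the right-hand side is the mean of the bound over that number.\<close>

lemma disp_mix:
  assumes bound: "\<And>L j. fam L \<Longrightarrow> fresh j L \<Longrightarrow> \<bar>disp i n L x - b\<bar> \<le> (if j = 0 then 0 else a) + c * real j"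
    and "finite V" "fam L" "finite W" "V \<inter> W = {}"
    and "\<And>y. y \<in> V \<Longrightarrow> \<exists>\<nu>. is_state \<nu> \<and> (\<forall>g\<in>bfun. L y g = \<kappa> * stat g + (1 - \<kappa>) * \<nu> g)"
    and "\<And>y g. y \<notin> V \<union> W \<Longrightarrow> g \<in> bfun \<Longrightarrow> L y g = stat g"
  shows "\<bar>disp i n L x - b\<bar>
    \<le> (if W = {} then a * (1 - \<kappa> ^ card V) else a) + c * (real (card W) + (1 - \<kappa>) * real (card V))"
  using assms(2-)
proof (induction V arbitrary: L W rule: finite_induct)
  case empty
  then have "fresh (card W) L" by (auto simp: fresh_def)
  from bound[OF empty.prems(1) this] show ?case using empty.prems(2) by (simp split: if_splits)
next
  case (insert y V)
  from insert.prems(4) obtain \<nu> where \<nu>: "is_state \<nu>" "\<And>g. g \<in> bfun \<Longrightarrow> L y g = \<kappa> * stat g + (1 - \<kappa>) * \<nu> g"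
    by blast
  \<comment> \<open>\<open>V\<close> holds the undecided sites, \<open>W\<close> those found not
    refreshed. Deciding \<open>y\<close> preserves the form of the bound since \<kappa> (1 -
    \<kappa>^m) + (1 - \<kappa>) = 1 - \<kappa>^(m+1); once \<open>W\<close> is nonempty, complete
    refreshing has failed and the coefficient stays \<open>a\<close>.\<close>
  let ?B = "\<lambda>W m. (if W = {} then a * (1 - \<kappa> ^ m) else a) + c * (real (card W) + (1 - \<kappa>) * real m)"
  let ?D = "\<lambda>L. disp i n L x"
  have y: "y \<notin> W" using insert.prems by auto
  have "(Pop ^^ n) (\<lambda>_ x. real_of_int (x $ i)) (L(y := L y)) x
      = \<kappa> * (Pop ^^ n) (\<lambda>_ x. real_of_int (x $ i)) (L(y := stat)) x
        + (1 - \<kappa>) * (Pop ^^ n) (\<lambda>_ x. real_of_int (x $ i)) (L(y := \<nu>)) x"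
    by (rule Pop_affine) (use insert.prems(1) \<nu> \<kappa> state_stat famD in auto)
  then have "?D L - b = \<kappa> * (?D (L(y := stat)) - b) + (1 - \<kappa>) * (?D (L(y := \<nu>)) - b)"
    by (simp add: disp_def algebra_simps)
  then have "\<bar>?D L - b\<bar> \<le> \<bar>\<kappa> * (?D (L(y := stat)) - b)\<bar> + \<bar>(1 - \<kappa>) * (?D (L(y := \<nu>)) - b)\<bar>"
    by (simp only: abs_triangle_ineq)
  also have "\<dots> = \<kappa> * \<bar>?D (L(y := stat)) - b\<bar> + (1 - \<kappa>) * \<bar>?D (L(y := \<nu>)) - b\<bar>"
    using \<kappa> by (simp add: abs_mult)
  also have "\<dots> \<le> \<kappa> * ?B W (card V) + (1 - \<kappa>) * ?B (insert y W) (card V)"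
  proof (intro add_mono mult_left_mono)
    show "\<bar>?D (L(y := stat)) - b\<bar> \<le> ?B W (card V)"
      by (rule insert.IH) (use insert.prems insert.hyps in \<open>auto simp: fam_def state_stat\<close>)
    show "\<bar>?D (L(y := \<nu>)) - b\<bar> \<le> ?B (insert y W) (card V)"
      by (rule insert.IH) (use insert.prems insert.hyps \<nu> in \<open>auto simp: fam_def\<close>)
  qed (use \<kappa> in auto)
  also have "\<dots> = ?B W (card (insert y V))"
    using insert.hyps insert.prems(2) y by (simp add: algebra_simps)
  finally show ?case .
qed

text \<open>After one step at most k + 1 sites are candidates for being non-stationary, each
  refreshed with probability \<kappa>; averaging the old bound gives the new one. The constant 2 is
  one unit for the jump and one for replacing \<open>\<beta> i n\<close> by
  \<open>\<beta> i (Suc n)\<close>.\<close>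

lemma disp_contract:
  assumes bound: "\<And>L x j. fam L \<Longrightarrow> fresh j L \<Longrightarrow>
      \<bar>disp i n L x - \<beta> i n\<bar> \<le> (if j = 0 then 0 else a) + c * real j"
    and ac: "0 \<le> a" "0 \<le> c" and L: "fam L" "fresh k L"
  shows "\<bar>disp i (Suc n) L x - \<beta> i (Suc n)\<bar>
    \<le> 2 + a * (1 - \<kappa> ^ Suc k) + c * ((1 - \<kappa>) * real (Suc k))"
proof -
  from L obtain U where U: "finite U" "card U \<le> k" "\<And>y g. y \<notin> U \<Longrightarrow> g \<in> bfun \<Longrightarrow> L y g = stat g"
    by (auto simp: fresh_def)
  have main: "\<bar>disp i n (step L x e) (x + e) - \<beta> i n\<bar> \<le> a * (1 - \<kappa> ^ Suc k) + c * ((1 - \<kappa>) * real (Suc k))"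
    if e: "e \<in> nbhd0" for e
  proof -
    \<comment> \<open>The current site joins even if it was stationary, because observing the jump
      biases its law.\<close>
    let ?V = "insert x U"
    have card: "card ?V \<le> Suc k" using U by (simp add: card_insert_if)
    have "\<bar>disp i n (step L x e) (x + e) - \<beta> i n\<bar>
      \<le> (if ({} :: (int ^ 'd) set) = {} then a * (1 - \<kappa> ^ card ?V) else a)
        + c * (real (card ({} :: (int ^ 'd) set)) + (1 - \<kappa>) * real (card ?V))"
    proof (rule disp_mix)
      show "\<exists>\<nu>. is_state \<nu> \<and> (\<forall>g\<in>bfun. step L x e y g = \<kappa> * stat g + (1 - \<kappa>) * \<nu> g)" for y
        unfolding step_def by (rule evolve_decomp) (use L e in \<open>auto intro: famD state_cond\<close>)
      show "step L x e y g = stat g" if "y \<notin> ?V \<union> {}" "g \<in> bfun" for y g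
        using that U(3)[of y "Kop g"] by (simp add: step_def evolve_def stat_evolve)
    qed (use bound U fam_step[OF L(1) e] in auto)
    also have "\<dots> \<le> a * (1 - \<kappa> ^ Suc k) + c * ((1 - \<kappa>) * real (Suc k))"
      using ac \<kappa> card by (auto intro!: add_mono mult_left_mono power_decreasing simp del: power_Suc)
    finally show ?thesis .
  qed
  have "\<bar>disp i (Suc n) L x - \<beta> i n\<bar> \<le> 1 + (a * (1 - \<kappa> ^ Suc k) + c * ((1 - \<kappa>) * real (Suc k)))"
    unfolding disp_Suc[OF L(1)]
  proof (rule convex_sum_bound[OF famD[OF L(1)]])
    fix e assume e: "e \<in> (nbhd0 :: (int ^ 'd) set)"
    have "\<bar>real_of_int (e $ i)\<bar> \<le> 1" using nbhd0_component[OF e, of i] by linarith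
    with main[OF e] show "\<bar>real_of_int (e $ i) + disp i n (step L x e) (x + e) - \<beta> i n\<bar>
        \<le> 1 + (a * (1 - \<kappa> ^ Suc k) + c * ((1 - \<kappa>) * real (Suc k)))"
      by linarith
  qed
  moreover have "\<bar>\<beta> i (Suc n) - \<beta> i n\<bar> \<le> 1" unfolding \<beta>_def by (rule disp_increment[OF fam_stat])
  ultimately show ?thesis by linarith
qed

text \<open>\<open>A \<cdot> 1{k > 0} + k\<close> is a Lyapunov function for the number \<open>k\<close> of non-stationary sites: it bounds twice the
  expected time until all of them are refreshed simultaneously.\<close>

lemma drift_constant:
  "\<exists>A\<ge>0. \<forall>k. 2 + A * (1 - \<kappa> ^ Suc k) + 1 * ((1 - \<kappa>) * real (Suc k)) \<le> A + 1 * real k"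
proof -
  \<comment> \<open>The claim rearranges to 3 - \<kappa> (k+1) \<le> A \<kappa>^(k+1), where 3 is
    the constant 2 plus the newly visited site. Beyond \<open>k0\<close> the left side is not
    positive; up to \<open>k0\<close> the choice of \<open>A\<close> makes the right side at least
    3.\<close>
  define k0 where "k0 = nat \<lceil>3 / \<kappa>\<rceil>"
  define A where "A = 3 / \<kappa> ^ Suc k0"
  have A: "0 \<le> A" using \<kappa> by (simp add: A_def)
  have "3 - \<kappa> * real (Suc k) \<le> A * \<kappa> ^ Suc k" for k
  proof (cases "k \<le> k0")
    case True
    have "\<kappa> ^ Suc k0 \<le> \<kappa> ^ Suc k" using True \<kappa> by (intro power_decreasing) auto
    then have "A * \<kappa> ^ Suc k0 \<le> A * \<kappa> ^ Suc k" by (rule mult_left_mono[OF _ A])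
    moreover have "A * \<kappa> ^ Suc k0 = 3" using \<kappa> by (simp add: A_def)
    moreover have "0 \<le> \<kappa> * real (Suc k)" using \<kappa> by simp
    ultimately show ?thesis by linarith
  next
    case False
    then have "3 / \<kappa> \<le> real (Suc k)" unfolding k0_def by linarith
    then have "3 \<le> \<kappa> * real (Suc k)" using \<kappa> by (simp add: field_simps)
    moreover have "0 \<le> A * \<kappa> ^ Suc k" using \<kappa> A by simp
    ultimately show ?thesis by linarith
  qed
  then show ?thesis using A by (intro exI[of _ A]) (simp add: algebra_simps del: power_Suc)
qed

text \<open>Two inductions on the number of steps are stacked. The last n - m steps use the Lyapunov
  bound, where the drift keeps the coefficients at A and 1. The m steps before them give up the
  drift and let the coefficient of the number of non-stationary sites shrink geometrically, so that
  it can absorb the size of the box.\<close>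

lemma disp_bound:
  "\<exists>A\<ge>0. \<forall>m n L x. m \<le> n \<longrightarrow> fam L \<longrightarrow>
    \<bar>disp i n L x - \<beta> i n\<bar> \<le> A + 3 * real m + (1 - \<kappa>) ^ m * (2 * real n + 1) ^ CARD('d)"
proof -
  from drift_constant obtain A where A: "0 \<le> A"
    "\<And>k. 2 + A * (1 - \<kappa> ^ Suc k) + 1 * ((1 - \<kappa>) * real (Suc k)) \<le> A + 1 * real k" by blast
  have 1: "\<bar>disp i n L x - \<beta> i n\<bar> \<le> (if k = 0 then 0 else A) + 1 * real k"
    if "fam L" "fresh k L" for n L x k
    using that
  proof (induction n arbitrary: L x k)
    case 0
    then show ?case using A(1) by (simp add: disp_def \<beta>_def)
  next
    case (Suc n)
    show ?case
    proof (cases "k = 0")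
      case True
      then show ?thesis using disp_fresh_0 Suc.prems(2) by simp
    next
      case False
      then show ?thesis using disp_contract[OF Suc.IH A(1) _ Suc.prems, of x] A(2)[of k] by simp
    qed
  qed
  \<comment> \<open>Each added step costs 3: the 2 of \<open>disp_contract\<close>, and at most 1
    for the site just visited, whose contribution is (1 - \<kappa>)^(m+1).\<close>
  have 2: "\<bar>disp i (m + n) L x - \<beta> i (m + n)\<bar> \<le> (if k = 0 then 0 else A + 3 * real m) + (1 - \<kappa>) ^ m * real k"
    if "fam L" "fresh k L" for m n L x k
    using that
  proof (induction m arbitrary: L x k)
    case 0
    then show ?case using 1[of L k n x] by (simp split: if_splits)
  next
    case (Suc m)
    show ?case
    proof (cases "k = 0")
      case True
      then show ?thesis using disp_fresh_0 Suc.prems(2) by simp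
    next
      case False
      let ?a = "A + 3 * real m" and ?c = "(1 - \<kappa>) ^ m"
      have a: "0 \<le> ?a" "0 \<le> ?c" using A(1) \<kappa> by auto
      have "\<bar>disp i (Suc (m + n)) L x - \<beta> i (Suc (m + n))\<bar>
          \<le> 2 + ?a * (1 - \<kappa> ^ Suc k) + ?c * ((1 - \<kappa>) * real (Suc k))"
        by (rule disp_contract[OF Suc.IH a Suc.prems])
      moreover have "?a * (1 - \<kappa> ^ Suc k) \<le> ?a * 1" using \<kappa> by (intro mult_left_mono a) simp
      moreover have "?c * ((1 - \<kappa>) * real (Suc k)) = (1 - \<kappa>) ^ Suc m * real k + (1 - \<kappa>) ^ Suc m"
        by (simp add: algebra_simps)
      moreover have "(1 - \<kappa>) ^ Suc m \<le> 1" using \<kappa> by (intro power_le_one) auto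
      ultimately show ?thesis using False by simp
    qed
  qed
  have "\<bar>disp i n L x - \<beta> i n\<bar> \<le> A + 3 * real m + (1 - \<kappa>) ^ m * (2 * real n + 1) ^ CARD('d)"
    if "m \<le> n" "fam L" for m n L x
  proof -
    \<comment> \<open>Within n steps \<open>L'\<close> cannot be told apart from \<open>L\<close>,
      and its non-stationary sites lie in the box.\<close>
    define L' where "L' y = (if near n x y then L y else stat)" for y
    have "(Pop ^^ n) (\<lambda>_ x. real_of_int (x $ i)) L x = (Pop ^^ n) (\<lambda>_ x. real_of_int (x $ i)) L' x"
      by (rule Pop_local) (simp add: L'_def)
    then have eq: "disp i n L x = disp i n L' x" by (simp add: disp_def)
    have f: "fam L'" using that by (auto simp: L'_def fam_def state_stat)
    have fr: "fresh (card {y. near n x y}) L'"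
      unfolding fresh_def by (intro exI[of _ "{y. near n x y}"]) (auto simp: finite_near L'_def)
    have "\<bar>disp i n L' x - \<beta> i n\<bar> \<le> (if card {y. near n x y} = 0 then 0 else A + 3 * real m)
        + (1 - \<kappa>) ^ m * real (card {y. near n x y})"
      using 2[OF f fr, of m "n - m" x] that by simp
    also have "\<dots> \<le> (A + 3 * real m) + (1 - \<kappa>) ^ m * real ((2 * n + 1) ^ CARD('d))"
      using A(1) \<kappa> card_near_le[of n x]
      by (intro add_mono mult_left_mono) (simp_all del: of_nat_power of_nat_add of_nat_mult)
    finally show ?thesis by (simp add: eq add.commute)
  qed
  with A(1) show ?thesis by blast
qed

end

section \<open>Second moments\<close>

text \<open>For blocks of length n = m^2 with forgetting time m, the size of the box is polynomial
  in m and is beaten by (1 - \<kappa>)^m \<le> exp (-\<kappa> m).\<close>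

lemma power_times_exponential_bounded:
  fixes \<kappa> :: real
  assumes "0 < \<kappa>" "\<kappa> \<le> 1"
  shows "\<exists>C. \<forall>m. (1 - \<kappa>) ^ m * (2 * (real m)\<^sup>2 + 1) ^ d \<le> C"
proof -
  have lim: "filterlim (\<lambda>m. \<kappa> * real m) at_top sequentially"
    using assms(1) by (intro filterlim_tendsto_pos_mult_at_top[OF tendsto_const _ filterlim_real_sequentially])
  have "(\<lambda>m. (\<kappa> * real m) ^ (2 * d) / exp (\<kappa> * real m)) \<longlonglongrightarrow> 0"
    by (rule filterlim_compose[OF tendsto_power_div_exp_0 lim])
  then have "Bseq (\<lambda>m. (\<kappa> * real m) ^ (2 * d) / exp (\<kappa> * real m))"
    by (rule convergent_imp_Bseq[OF convergentI])
  then obtain B where B: "\<And>m. norm ((\<kappa> * real m) ^ (2 * d) / exp (\<kappa> * real m)) \<le> B"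
    unfolding Bseq_def by blast
  \<comment> \<open>The \<open>max 1\<close> covers m = 0, where the estimate 2 m^2 + 1 \<le> 3 m^2
    fails.\<close>
  have "(1 - \<kappa>) ^ m * (2 * (real m)\<^sup>2 + 1) ^ d \<le> max 1 (3 ^ d * B / \<kappa> ^ (2 * d))" for m
  proof (cases "m = 0")
    case False
    have 1: "(1 - \<kappa>) ^ m \<le> exp (- \<kappa>) ^ m"
      using assms exp_ge_add_one_self[of "- \<kappa>"] by (intro power_mono) auto
    have "1 \<le> (real m)\<^sup>2" using False by simp
    then have 2: "(2 * (real m)\<^sup>2 + 1) ^ d \<le> (3 * (real m)\<^sup>2) ^ d" by (intro power_mono) auto
    have "(1 - \<kappa>) ^ m * (2 * (real m)\<^sup>2 + 1) ^ d \<le> exp (- \<kappa>) ^ m * (3 * (real m)\<^sup>2) ^ d"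
      using 1 2 assms by (intro mult_mono) auto
    also have "exp (- \<kappa>) ^ m * (3 * (real m)\<^sup>2) ^ d = 3 ^ d / \<kappa> ^ (2 * d) * ((\<kappa> * real m) ^ (2 * d) / exp (\<kappa> * real m))"
      using assms(1) by (simp add: exp_of_nat_mult[symmetric] exp_minus field_simps power_mult_distrib flip: power_mult)
    also have "\<dots> \<le> 3 ^ d / \<kappa> ^ (2 * d) * B"
      using B[of m] assms(1) by (intro mult_left_mono) auto
    finally show ?thesis by simp
  qed simp
  then show ?thesis by blast
qed

context minorized_environment
begin

lemma disp_abs_le:
  assumes "fam L"
  shows "\<bar>disp i n L x\<bar> \<le> real n"
proof (induction n)
  case (Suc n)
  then show ?case using disp_increment[OF assms, of i n x] by simp
qed (simp add: disp_def)

text \<open>Markov property at time m: the bound \<open>g\<close> is uniform over families and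
  positions, so it applies to whatever state the first m steps lead to.\<close>

lemma disp_add:
  assumes L: "fam L" and g: "\<And>L x. fam L \<Longrightarrow> \<bar>disp i n L x - b\<bar> \<le> g"
  shows "\<bar>disp i (m + n) L x - disp i m L x - b\<bar> \<le> g"
proof -
  let ?X = "\<lambda>_ x. real_of_int (x $ i)"
  have b: "\<bar>(Pop ^^ n) ?X L' x' - real_of_int (x' $ i) - b\<bar> \<le> g" if "fam L'" for L' x'
    using g[OF that, of x'] by (simp add: disp_def)
  have "(Pop ^^ (m + n)) ?X L x = (Pop ^^ m) ((Pop ^^ n) ?X) L x" by (simp add: funpow_add)
  moreover have "(Pop ^^ m) ((Pop ^^ n) ?X) L x \<le> (Pop ^^ m) (\<lambda>L x. 1 * ?X L x + (b + g) * 1) L x"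
    using b by (intro Pop_pow_mono L) (auto simp: abs_le_iff algebra_simps)
  moreover have "(Pop ^^ m) (\<lambda>L x. 1 * ?X L x + (b - g) * 1) L x \<le> (Pop ^^ m) ((Pop ^^ n) ?X) L x"
    using b by (intro Pop_pow_mono L) (auto simp: abs_le_iff algebra_simps)
  ultimately show ?thesis
    unfolding Pop_pow_lin[of m _ _ _ "\<lambda>_ _. 1"] Pop_pow_const[OF L] disp_def unfolding mult_1 mult_1_right
    by linarith
qed

lemma \<beta>_mult:
  assumes g: "\<And>L x. fam L \<Longrightarrow> \<bar>disp i n L x - \<beta> i n\<bar> \<le> g"
  shows "\<bar>\<beta> i (k * n) - real k * \<beta> i n\<bar> \<le> real k * g"
proof (induction k)
  case (Suc k)
  have "\<bar>\<beta> i (k * n + n) - \<beta> i (k * n) - \<beta> i n\<bar> \<le> g"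
    using disp_add[OF fam_stat g] by (simp add: \<beta>_def)
  with Suc show ?case by (simp add: algebra_simps abs_le_iff)
qed (simp add: \<beta>_def disp_def)

text \<open>If every block had conditional mean exactly \<open>b\<close>, the centred block
  displacements, of size at most 2n, would be orthogonal and contribute at most 4 n^2 each. A
  conditional mean off by \<open>g\<close> is multiplied by the current deviation, which grows by at
  most 2n per block; this is the middle term.\<close>

lemma second_moment:
  assumes g: "\<And>L x. fam L \<Longrightarrow> \<bar>disp i n L x - b\<bar> \<le> g" and b: "\<bar>b\<bar> \<le> real n" and "fam L"
  shows "(Pop ^^ (k * n)) (\<lambda>_ x. (real_of_int (x $ i) - c)\<^sup>2) L x
    \<le> (real_of_int (x $ i) + real k * b - c)\<^sup>2
      + 2 * g * real k * (\<bar>real_of_int (x $ i) + real k * b - c\<bar> + 2 * real n * real k)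
      + 4 * (real n)\<^sup>2 * real k"
  using assms(3)
proof (induction k arbitrary: L x)
  case (Suc k)
  let ?F = "\<lambda>_ x. (real_of_int (x $ i) - c)\<^sup>2"
  let ?X = "\<lambda>_ x. real_of_int (x $ i)"
  have g0: "0 \<le> g" using g[OF Suc.prems, of x] by linarith
  define w where "w = real_of_int (x $ i) + real (Suc k) * b - c"
  \<comment> \<open>\<open>R\<close> collects all that is independent of the position after the
    first block. The bound becomes affine in that position, so its mean is controlled by
    \<open>disp\<close> alone.\<close>
  define R where "R = w\<^sup>2 - 2 * w * (real_of_int (x $ i) + b) + 4 * (real n)\<^sup>2
      + 2 * g * real k * (\<bar>w\<bar> + 2 * real n + 2 * real n * real k) + 4 * (real n)\<^sup>2 * real k"
  have "(Pop ^^ (Suc k * n)) ?F L x = (Pop ^^ n) ((Pop ^^ (k * n)) ?F) L x" by (simp add: funpow_add)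
  also have "\<dots> \<le> (Pop ^^ n) (\<lambda>L x. (2 * w) * ?X L x + R * 1) L x"
  proof (rule Pop_pow_mono[OF Suc.prems])
    fix L' x' assume L': "fam L'" and x': "near n x x'"
    define z where "z = real_of_int (x' $ i) - real_of_int (x $ i) - b"
    have "\<bar>x' $ i - x $ i\<bar> \<le> int n" using x' by (auto simp: near_def)
    then have "\<bar>real_of_int (x' $ i) - real_of_int (x $ i)\<bar> \<le> real n" by linarith
    then have z: "\<bar>z\<bar> \<le> 2 * real n" using b unfolding z_def by linarith
    have z2: "z\<^sup>2 \<le> 4 * (real n)\<^sup>2"
      using power_mono[OF z, of 2] by (simp add: power_mult_distrib)
    have eq: "real_of_int (x' $ i) + real k * b - c = w + z" by (simp add: w_def z_def algebra_simps)
    have "(Pop ^^ (k * n)) ?F L' x' \<le> (w + z)\<^sup>2 + 2 * g * real k * (\<bar>w + z\<bar> + 2 * real n * real k)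
        + 4 * (real n)\<^sup>2 * real k"
      using Suc.IH[OF L', of x'] unfolding eq .
    also have "\<dots> \<le> (w\<^sup>2 + 2 * w * z + 4 * (real n)\<^sup>2)
        + 2 * g * real k * (\<bar>w\<bar> + 2 * real n + 2 * real n * real k) + 4 * (real n)\<^sup>2 * real k"
    proof (intro add_mono order_refl mult_left_mono)
      show "(w + z)\<^sup>2 \<le> w\<^sup>2 + 2 * w * z + 4 * (real n)\<^sup>2" using z2 by (simp add: power2_sum)
      show "\<bar>w + z\<bar> \<le> \<bar>w\<bar> + 2 * real n" using z by linarith
    qed (use g0 in auto)
    also have "\<dots> = 2 * w * real_of_int (x' $ i) + R * 1" by (simp add: R_def z_def algebra_simps)
    finally show "(Pop ^^ (k * n)) ?F L' x' \<le> 2 * w * real_of_int (x' $ i) + R * 1" .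
  qed
  also have "\<dots> = 2 * w * (real_of_int (x $ i) + disp i n L x) + R"
    unfolding Pop_pow_lin Pop_pow_const[OF Suc.prems] by (simp add: disp_def)
  also have "\<dots> = w\<^sup>2 + 2 * (w * (disp i n L x - b)) + 4 * (real n)\<^sup>2
      + 2 * g * real k * (\<bar>w\<bar> + 2 * real n + 2 * real n * real k) + 4 * (real n)\<^sup>2 * real k"
    by (simp add: R_def algebra_simps)
  also have "\<dots> \<le> w\<^sup>2 + 2 * (\<bar>w\<bar> * g) + 4 * (real n)\<^sup>2
      + 2 * g * real k * (\<bar>w\<bar> + 2 * real n + 2 * real n * real k) + 4 * (real n)\<^sup>2 * real k"
  proof -
    have "w * (disp i n L x - b) \<le> \<bar>w\<bar> * \<bar>disp i n L x - b\<bar>"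
      unfolding abs_mult[symmetric] by (rule abs_ge_self)
    also have "\<dots> \<le> \<bar>w\<bar> * g" by (intro mult_left_mono g Suc.prems) simp
    finally show ?thesis by simp
  qed
  also have "\<dots> \<le> w\<^sup>2 + 2 * g * real (Suc k) * (\<bar>w\<bar> + 2 * real n * real (Suc k)) + 4 * (real n)\<^sup>2 * real (Suc k)"
    using g0 mult_nonneg_nonneg[OF g0, of "real n"] mult_nonneg_nonneg[OF mult_nonneg_nonneg[OF g0, of "real n"], of "real k"]
    by (simp add: algebra_simps)
  finally show ?case by (simp only: w_def)
qed simp

text \<open>The time scale: \<open>j\<^sup>4\<close> blocks of length \<open>j\<^sup>4\<close>, each allowed \<open>j\<^sup>2\<close> steps to forget its initial state,
  which makes the second moments summable over \<open>j\<close>.\<close>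

lemma moment_bound:
  "\<exists>v C. (\<lambda>j. \<beta> i (j ^ 4) / real j ^ 4) \<longlonglongrightarrow> v \<and>
    (\<forall>j\<ge>1. (Pop ^^ (j ^ 8)) (\<lambda>_ x. (real_of_int (x $ i) / real j ^ 8 - \<beta> i (j ^ 4) / real j ^ 4)\<^sup>2)
        (\<lambda>_. stat) 0 \<le> C / real j ^ 2)"
proof -
  obtain A where A: "0 \<le> A" "\<And>m n L x. m \<le> n \<Longrightarrow> fam L \<Longrightarrow>
      \<bar>disp i n L x - \<beta> i n\<bar> \<le> A + 3 * real m + (1 - \<kappa>) ^ m * (2 * real n + 1) ^ CARD('d)"
    using disp_bound[of i] by blast
  obtain B where B: "\<And>m. (1 - \<kappa>) ^ m * (2 * (real m)\<^sup>2 + 1) ^ CARD('d) \<le> B"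
    using power_times_exponential_bounded[OF \<kappa>] by blast
  define D where "D = \<bar>A\<bar> + \<bar>B\<bar> + 3"
  have D: "0 \<le> D" by (simp add: D_def)
  have g: "\<bar>disp i (j ^ 4) L x - \<beta> i (j ^ 4)\<bar> \<le> D * real j ^ 2" if "fam L" "1 \<le> j" for j L x
  proof -
    have "\<bar>disp i (j ^ 4) L x - \<beta> i (j ^ 4)\<bar>
        \<le> A + 3 * real (j ^ 2) + (1 - \<kappa>) ^ (j ^ 2) * (2 * real (j ^ 4) + 1) ^ CARD('d)"
      using that by (intro A(2)) (auto intro: power_increasing)
    also have "real (j ^ 4) = (real (j ^ 2))\<^sup>2" by simp
    also have "A + 3 * real (j ^ 2) + (1 - \<kappa>) ^ (j ^ 2) * (2 * (real (j ^ 2))\<^sup>2 + 1) ^ CARD('d)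
        \<le> A + 3 * real (j ^ 2) + B"
      using B[of "j ^ 2"] by simp
    also have "\<dots> \<le> (\<bar>A\<bar> + \<bar>B\<bar>) * 1 + 3 * real j ^ 2" by simp
    also have "\<dots> \<le> (\<bar>A\<bar> + \<bar>B\<bar>) * real j ^ 2 + 3 * real j ^ 2"
      using that by (intro add_mono mult_left_mono) auto
    finally show ?thesis by (simp add: D_def algebra_simps)
  qed
  define r where "r j = \<beta> i (j ^ 4) / real j ^ 4" for j
  \<comment> \<open>The length k^4 j^4 consists of k^4 blocks of length j^4 and also of j^4 blocks
    of length k^4. Comparing \<open>r j\<close> and \<open>r k\<close> with this common multiple
    yields the Cauchy property.\<close>
  have half: "\<bar>\<beta> i (k ^ 4 * j ^ 4) / (real k ^ 4 * real j ^ 4) - r j\<bar> \<le> D / real j ^ 2" if "1 \<le> j" "1 \<le> k" for j k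
  proof -
    have "\<bar>\<beta> i (k ^ 4 * j ^ 4) - real (k ^ 4) * \<beta> i (j ^ 4)\<bar> \<le> real (k ^ 4) * (D * real j ^ 2)"
      by (rule \<beta>_mult) (rule g[OF _ that(1)])
    then have "\<bar>\<beta> i (k ^ 4 * j ^ 4) - real (k ^ 4) * \<beta> i (j ^ 4)\<bar> / (real k ^ 4 * real j ^ 4)
        \<le> (real k ^ 4 * (D * real j ^ 2)) / (real k ^ 4 * real j ^ 4)"
      by (intro divide_right_mono) auto
    also have "\<dots> = D / real j ^ 2" using that by (simp add: field_simps power4_eq_xxxx power2_eq_square)
    also have "\<bar>\<beta> i (k ^ 4 * j ^ 4) - real (k ^ 4) * \<beta> i (j ^ 4)\<bar> / (real k ^ 4 * real j ^ 4)
        = \<bar>(\<beta> i (k ^ 4 * j ^ 4) - real (k ^ 4) * \<beta> i (j ^ 4)) / (real k ^ 4 * real j ^ 4)\<bar>"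
      by (simp add: abs_divide)
    also have "(\<beta> i (k ^ 4 * j ^ 4) - real (k ^ 4) * \<beta> i (j ^ 4)) / (real k ^ 4 * real j ^ 4)
        = \<beta> i (k ^ 4 * j ^ 4) / (real k ^ 4 * real j ^ 4) - r j"
      using that by (simp add: r_def diff_divide_distrib)
    finally show ?thesis .
  qed
  have rr: "\<bar>r j - r k\<bar> \<le> D / real j ^ 2 + D / real k ^ 2" if "1 \<le> j" "1 \<le> k" for j k
    using half[OF that] half[OF that(2) that(1)] by (simp add: mult.commute[of "j ^ 4"] mult.commute[of "real j ^ 4"])
  have lim: "(\<lambda>j. D / real j ^ 2) \<longlonglongrightarrow> 0"
    by (intro real_tendsto_divide_at_top[OF tendsto_const] filterlim_pow_at_top filterlim_real_sequentially) simp
  have "Cauchy r"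
  proof (rule metric_CauchyI)
    fix e :: real assume "0 < e"
    then have "eventually (\<lambda>j. D / real j ^ 2 < e / 2) sequentially" by (intro order_tendstoD[OF lim]) simp
    then obtain J where J: "\<And>j. J \<le> j \<Longrightarrow> D / real j ^ 2 < e / 2" by (auto simp: eventually_sequentially)
    show "\<exists>J. \<forall>j\<ge>J. \<forall>k\<ge>J. dist (r j) (r k) < e"
    proof (intro exI[of _ "Suc J"] allI impI)
      fix j k assume "Suc J \<le> j" "Suc J \<le> k"
      then show "dist (r j) (r k) < e" using rr[of j k] J[of j] J[of k] unfolding dist_real_def by linarith
    qed
  qed
  then obtain v where v: "r \<longlonglongrightarrow> v" using Cauchy_convergent convergent_def by blast
  have "(Pop ^^ (j ^ 8)) (\<lambda>_ x. (real_of_int (x $ i) / real j ^ 8 - r j)\<^sup>2) (\<lambda>_. stat) 0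
      \<le> (4 * D + 4) / real j ^ 2" if j: "1 \<le> j" for j
  proof -
    \<comment> \<open>The centre is the predicted mean, so the initial deviation is zero and 4 D
      j^14 + 4 j^12 remains; dividing by j^16 leaves order 1 / j^2.\<close>
    let ?n = "j ^ 4" and ?F = "\<lambda>_ x. (real_of_int (x $ i) - real (j ^ 4) * \<beta> i (j ^ 4))\<^sup>2"
    have n: "?n * ?n = j ^ 8" by (simp flip: power_add)
    have j0: "real j \<noteq> 0" using j by simp
    have "(Pop ^^ (?n * ?n)) ?F (\<lambda>_. stat) 0
        \<le> (real_of_int (0 $ i) + real ?n * \<beta> i ?n - real (j ^ 4) * \<beta> i (j ^ 4))\<^sup>2
          + 2 * (D * real j ^ 2) * real ?n * (\<bar>real_of_int (0 $ i) + real ?n * \<beta> i ?n - real (j ^ 4) * \<beta> i (j ^ 4)\<bar>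
          + 2 * real ?n * real ?n) + 4 * (real ?n)\<^sup>2 * real ?n"
      by (rule second_moment) (use disp_abs_le[OF fam_stat, of i ?n 0] g j in \<open>auto simp: \<beta>_def fam_stat\<close>)
    also have "\<dots> = 4 * D * real j ^ 14 + 4 * real j ^ 12"
      by (simp add: algebra_simps flip: power_add power_mult)
    also have "\<dots> \<le> 4 * D * real j ^ 14 + 4 * real j ^ 14"
      using j by (intro add_left_mono mult_left_mono power_increasing) auto
    finally have le: "(Pop ^^ (j ^ 8)) ?F (\<lambda>_. stat) 0 \<le> (4 * D + 4) * real j ^ 14"
      by (simp add: n algebra_simps)
    have "(\<lambda>_ x. (real_of_int (x $ i) / real j ^ 8 - r j)\<^sup>2)
        = (\<lambda>L x. (1 / real j ^ 16) * ?F L x + 0 * ?F L x)"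
    proof (intro ext)
      fix L and x :: "int ^ 'd"
      have "real_of_int (x $ i) / real j ^ 8 - r j = (real_of_int (x $ i) - real (j ^ 4) * \<beta> i (j ^ 4)) / real j ^ 8"
        using j0 by (simp add: r_def field_simps flip: power_add)
      then show "(real_of_int (x $ i) / real j ^ 8 - r j)\<^sup>2 = (1 / real j ^ 16) * ?F L x + 0 * ?F L x"
        by (simp add: power_divide flip: power_mult)
    qed
    then have "(Pop ^^ (j ^ 8)) (\<lambda>_ x. (real_of_int (x $ i) / real j ^ 8 - r j)\<^sup>2) (\<lambda>_. stat) 0
        = (Pop ^^ (j ^ 8)) (\<lambda>L x. (1 / real j ^ 16) * ?F L x + 0 * ?F L x) (\<lambda>_. stat) 0"
      by (rule arg_cong)
    also have "\<dots> = (1 / real j ^ 16) * (Pop ^^ (j ^ 8)) ?F (\<lambda>_. stat) 0"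
      by (subst Pop_pow_lin) simp
    also have "\<dots> \<le> (1 / real j ^ 16) * ((4 * D + 4) * real j ^ 14)" by (intro mult_left_mono le) simp
    also have "\<dots> = (4 * D + 4) / real j ^ 2" using j0 by (simp add: field_simps flip: power_add)
    finally show ?thesis .
  qed
  with v show ?thesis unfolding r_def[abs_def] by blast
qed

end

section \<open>Path probabilities\<close>

text \<open>The integrand sees only the coordinates in \<open>V\<close>; projecting to the finite
  product reduces the claim to Fubini. It will be used with one factor per visited site.\<close>

lemma nn_integral_PiM_UNIV_prod:
  fixes f :: "'i \<Rightarrow> 'a \<Rightarrow> ennreal"
  assumes Q: "\<And>i. prob_space (Q i)" and V: "finite V" and f: "\<And>i. i \<in> V \<Longrightarrow> f i \<in> borel_measurable (Q i)"
  shows "(\<integral>\<^sup>+\<omega>. (\<Prod>i\<in>V. f i (\<omega> i)) \<partial>PiM UNIV Q) = (\<Prod>i\<in>V. \<integral>\<^sup>+x. f i x \<partial>Q i)"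
proof -
  interpret product_prob_space Q UNIV
    by (simp add: product_prob_space_def product_prob_space_axioms_def product_sigma_finite_def Q
        prob_space_imp_sigma_finite)
  have m: "(\<lambda>\<omega>. \<Prod>i\<in>V. f i (\<omega> i)) \<in> borel_measurable (PiM V Q)"
    by (intro borel_measurable_prod_ennreal measurable_compose[where g="f _", OF measurable_component_singleton] f)
  have "(\<integral>\<^sup>+\<omega>. (\<Prod>i\<in>V. f i (\<omega> i)) \<partial>PiM UNIV Q) = (\<integral>\<^sup>+\<omega>. (\<Prod>i\<in>V. f i (restrict \<omega> V i)) \<partial>PiM UNIV Q)"
    by (intro nn_integral_cong prod.cong) auto
  also have "\<dots> = (\<integral>\<^sup>+\<omega>. (\<Prod>i\<in>V. f i (\<omega> i)) \<partial>distr (PiM UNIV Q) (PiM V Q) (\<lambda>\<omega>. restrict \<omega> V))"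
    by (intro nn_integral_distr[symmetric] measurable_restrict_subset) (use m in auto)
  also have "distr (PiM UNIV Q) (PiM V Q) (\<lambda>\<omega>. restrict \<omega> V) = PiM V Q"
    by (rule distr_PiM_restrict_finite[OF V]) auto
  also have "(\<integral>\<^sup>+\<omega>. (\<Prod>i\<in>V. f i (\<omega> i)) \<partial>PiM V Q) = (\<Prod>i\<in>V. \<integral>\<^sup>+x. f i x \<partial>Q i)"
    by (rule product_nn_integral_prod[OF V f])
  finally show ?thesis .
qed

definition jumps :: "nat \<Rightarrow> (int ^ 'd::finite) list set" where
  "jumps n = {es. set es \<subseteq> nbhd0 \<and> length es = n}"

lemma finite_jumps: "finite (jumps n)"
  unfolding jumps_def by (rule finite_lists_length_eq[OF finite_nbhd0])

lemma jumps_Suc: "jumps (Suc n) = (\<lambda>(e, es). e # es) ` (nbhd0 \<times> jumps n)"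
  by (auto simp: jumps_def length_Suc_conv image_iff)

lemma sum_jumps_Suc: "(\<Sum>es\<in>jumps (Suc n). f es) = (\<Sum>e\<in>nbhd0. \<Sum>es\<in>jumps n. f (e # es))"
  unfolding jumps_Suc
  by (subst sum.reindex) (auto simp: inj_on_def sum.cartesian_product intro!: sum.cong)

definition pos :: "(int ^ 'd::finite) list \<Rightarrow> int ^ 'd \<Rightarrow> nat \<Rightarrow> int ^ 'd" where
  "pos es x i = x + sum_list (take i es)"

lemma pos_0 [simp]: "pos es x 0 = x"
  by (simp add: pos_def)

lemma pos_Cons_Suc [simp]: "pos (e # es) x (Suc i) = pos es (x + e) i"
  by (simp add: pos_def add.assoc)

lemma pos_Suc: "i < length es \<Longrightarrow> pos es x (Suc i) - pos es x i = es ! i"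
  by (simp add: pos_def take_Suc_conv_app_nth)

context minorized_environment
begin

section \<open>Path weights, ordered by time and by site\<close>

fun weight :: "(int ^ 'd \<Rightarrow> 's state) \<Rightarrow> int ^ 'd \<Rightarrow> (int ^ 'd) list \<Rightarrow> real" where
  "weight L x [] = 1"
| "weight L x (e # es) = L x (w e) * weight (step L x e) (x + e) es"

text \<open>The factors that a path extracts from the chain at the single site \<open>y\<close>, one
  per time: the jump probability if the walk is there, otherwise 1.\<close>

fun site_weights :: "int ^ 'd \<Rightarrow> int ^ 'd \<Rightarrow> (int ^ 'd) list \<Rightarrow> ('s \<Rightarrow> real) list" where
  "site_weights y x [] = []"
| "site_weights y x (e # es) = (if y = x then w e else (\<lambda>_. 1)) # site_weights y (x + e) es"

text \<open>Backward Feynman-Kac recursion: the mean of the product of the \<open>g_i (Y_i)\<close>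
  along a chain Y started at s.\<close>

fun chain_weight :: "('s \<Rightarrow> real) list \<Rightarrow> 's \<Rightarrow> real" where
  "chain_weight [] = (\<lambda>_. 1)"
| "chain_weight (g # gs) = (\<lambda>s. g s * Kop (chain_weight gs) s)"

lemma Pop_pow_paths:
  "(Pop ^^ n) (\<lambda>_. h) L x = (\<Sum>es\<in>jumps n. weight L x es * h (pos es x n))"
proof (induction n arbitrary: L x)
  case 0
  have "jumps 0 = {[] :: (int ^ 'd) list}" by (auto simp: jumps_def)
  then show ?case by simp
next
  case (Suc n)
  show ?case unfolding Pop_Suc sum_jumps_Suc Suc.IH by (simp add: sum_distrib_left mult.assoc)
qed

lemma weight_nonneg:
  assumes "fam L" "set es \<subseteq> nbhd0"
  shows "0 \<le> weight L x es"
  using assms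
proof (induction es arbitrary: L x)
  case (Cons e es)
  then have "0 \<le> L x (w e)" "0 \<le> weight (step L x e) (x + e) es"
    by (auto intro: state_w_nonneg[OF famD] fam_step)
  then show ?case by simp
qed simp

lemma length_site_weights [simp]: "length (site_weights y x es) = length es"
  by (induction es arbitrary: x) auto

lemma site_weights_nth:
  "i < length es \<Longrightarrow> site_weights y x es ! i = (if y = pos es x i then w (es ! i) else (\<lambda>_. 1))"
proof (induction es arbitrary: x i)
  case (Cons e es)
  then show ?case by (cases i) auto
qed simp

lemma site_weights_set:
  assumes "set es \<subseteq> nbhd0" "g \<in> set (site_weights y x es)"
  shows "g \<in> bfun" "s \<in> space M \<Longrightarrow> 0 \<le> g s"
proof -
  have "g \<in> w ` nbhd0 \<union> {\<lambda>_. 1}"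
    using assms by (induction es arbitrary: x) (auto split: if_splits)
  then show "g \<in> bfun" "s \<in> space M \<Longrightarrow> 0 \<le> g s" by (auto simp: w_nonneg)
qed

lemma chain_weight_bfun:
  assumes "set gs \<subseteq> bfun"
  shows "chain_weight gs \<in> bfun"
  using assms by (induction gs) (auto intro!: bfun_mult)

lemma chain_weight_nonneg:
  assumes "\<And>g s. g \<in> set gs \<Longrightarrow> s \<in> space M \<Longrightarrow> 0 \<le> g s" "s \<in> space M"
  shows "0 \<le> chain_weight gs s"
  using assms
proof (induction gs arbitrary: s)
  case (Cons g gs)
  have "0 \<le> Kop (chain_weight gs) s"
    by (rule Kop_nonneg[OF Cons.IH Cons.prems(2)]) (use Cons.prems(1) in auto)
  then show ?case using Cons.prems by simp
qed simp

text \<open>Successive conditioning lists the factors in time order; since a step touches sites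
  separately and \<open>cond_mult\<close> cancels the normalization, they regroup by site. Allowing
  any finite \<open>V\<close> that contains the jump positions lets the same \<open>V\<close> serve
  for the rest of the path.\<close>

lemma weight_prod:
  assumes "fam L" "set es \<subseteq> nbhd0" "finite V" "\<And>i. i < length es \<Longrightarrow> pos es x i \<in> V"
  shows "weight L x es = (\<Prod>y\<in>V. L y (chain_weight (site_weights y x es)))"
  using assms
proof (induction es arbitrary: L x)
  case Nil
  then show ?case by (simp add: state_1 famD)
next
  case (Cons e es)
  have e: "e \<in> nbhd0" and es: "set es \<subseteq> nbhd0" using Cons.prems(2) by auto
  have x: "x \<in> V" using Cons.prems(4)[of 0] by simp
  let ?g = "\<lambda>y. chain_weight (site_weights y (x + e) es)"
  have g: "?g y \<in> bfun" for y using site_weights_set(1)[OF es] by (intro chain_weight_bfun) auto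
  have "weight (step L x e) (x + e) es = (\<Prod>y\<in>V. step L x e y (?g y))"
    by (rule Cons.IH[OF fam_step[OF Cons.prems(1) e] es Cons.prems(3)])
      (use Cons.prems(4)[of "Suc _"] in simp)
  also have "\<dots> = step L x e x (?g x) * (\<Prod>y\<in>V - {x}. step L x e y (?g y))"
    using Cons.prems(3) x by (simp add: prod.remove)
  also have "(\<Prod>y\<in>V - {x}. step L x e y (?g y)) = (\<Prod>y\<in>V - {x}. L y (chain_weight (site_weights y x (e # es))))"
    by (intro prod.cong) (auto simp: step_def evolve_def)
  finally have "weight L x (e # es) = (L x (w e) * step L x e x (?g x)) *
      (\<Prod>y\<in>V - {x}. L y (chain_weight (site_weights y x (e # es))))"
    by simp
  also have "L x (w e) * step L x e x (?g x) = L x (chain_weight (site_weights x x (e # es)))"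
    using cond_mult[OF famD[OF Cons.prems(1)] e Kop_bfun[OF g]] by (simp add: step_def evolve_def)
  also have "\<dots> * (\<Prod>y\<in>V - {x}. L y (chain_weight (site_weights y x (e # es))))
      = (\<Prod>y\<in>V. L y (chain_weight (site_weights y x (e # es))))"
    using Cons.prems(3) x by (simp only: prod.remove)
  finally show ?case .
qed

lemma nn_integral_bfun:
  assumes "g \<in> bfun" "\<And>s. s \<in> space M \<Longrightarrow> 0 \<le> g s"
  shows nn_integral_K: "s \<in> space M \<Longrightarrow> (\<integral>\<^sup>+u. ennreal (g u) \<partial>K s) = ennreal (Kop g s)"
    and nn_integral_stat: "(\<integral>\<^sup>+u. ennreal (g u) \<partial>\<pi>) = ennreal (stat g)"
proof -
  show "(\<integral>\<^sup>+u. ennreal (g u) \<partial>K s) = ennreal (Kop g s)" if s: "s \<in> space M"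
    unfolding Kop_def using assms(2) space_K[OF s]
    by (intro nn_integral_eq_integral bfun_integrable[OF assms(1) prob_K[OF s] sets_K[OF s]] AE_I2) simp
  show "(\<integral>\<^sup>+u. ennreal (g u) \<partial>\<pi>) = ennreal (stat g)"
    unfolding stat_def using assms(2) space_\<pi>
    by (intro nn_integral_eq_integral bfun_integrable[OF assms(1) prob_\<pi> sets_\<pi>] AE_I2) simp
qed

lemma nn_integral_chain_law:
  assumes gs: "\<And>g. g \<in> set gs \<Longrightarrow> g \<in> bfun" "\<And>g s. g \<in> set gs \<Longrightarrow> s \<in> space M \<Longrightarrow> 0 \<le> g s"
  shows "(\<integral>\<^sup>+X. (\<Prod>i<length gs. ennreal ((gs ! i) (X i))) \<partial>chain_law M \<pi> (\<lambda>_. K)) = ennreal (stat (chain_weight gs))"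
proof -
  have \<pi>: "\<pi> \<in> space (prob_algebra M)" using stationary by (simp add: stationary_dist_def)
  interpret Ionescu_Tulcea "chain_step \<pi> (\<lambda>_. K)" "\<lambda>_. M"
    by (rule Ionescu_Tulcea_chain_step[OF \<pi> kernel])
  let ?M = "\<lambda>_::nat. M" and ?C = "\<lambda>k. C 0 k (\<lambda>_. undefined)" and ?n = "length gs"
  have CI: "CI {0..<k} = ?C k" for k
  proof (rule measure_eqI)
    show "sets (CI {0..<k}) = sets (?C k)" by (simp add: PF.sets_P sets_C)
    fix B assume "B \<in> sets (CI {0..<k})"
    then have B: "B \<in> sets (PiM {0..<k} ?M)" by (simp add: PF.sets_P)
    show "emeasure (CI {0..<k}) B = emeasure (?C k) B"
      using sets.sets_into_space[OF B]
      by (subst emeasure_CI[OF subset_refl B]) (simp add: prod_emb_id space_PiM)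
  qed
  have D: "?C k = distr PF.lim (PiM {0..<k} ?M) (\<lambda>x. restrict x {0..<k})" for k
    by (simp add: distr_lim CI)
  have sC: "sets (?C k) = sets (PiM {0..<k} ?M)" for k by (simp add: sets_C)
  have spC: "space (?C k) = space (PiM {0..<k} ?M)" for k using sC by (rule sets_eq_imp_space_eq)
  have comp: "(\<lambda>x. x i) \<in> PiM {0..<k} ?M \<rightarrow>\<^sub>M M" if "i < k" for i k
    using that by (intro measurable_component_singleton) auto
  have gm: "(\<lambda>x. ennreal ((gs ! i) (x i))) \<in> borel_measurable (PiM {0..<k} ?M)" if "i < k" "i < ?n" for i k
  proof -
    have "gs ! i \<in> borel_measurable M" using gs(1)[of "gs ! i"] that(2) by (simp add: bfun_def)
    from measurable_compose[OF comp[OF that(1)] this] show ?thesis by simp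
  qed
  \<comment> \<open>The first k factors are kept, and all later ones are condensed into \<phi> at
    time k. Integrating out one coordinate replaces \<phi> by \<open>gs ! k\<close> times
    \<open>Kop \<phi>\<close>, which is the recursion of \<open>chain_weight\<close>.\<close>
  define R where "R k \<phi> = (\<integral>\<^sup>+x. (\<Prod>i<k. ennreal ((gs ! i) (x i))) * ennreal (\<phi> (x k)) \<partial>?C (Suc k))"
    for k and \<phi> :: "'s \<Rightarrow> real"
  have int_Suc: "(\<integral>\<^sup>+x. f x \<partial>?C (Suc k)) = (\<integral>\<^sup>+x. \<integral>\<^sup>+a. f (x(k := a)) \<partial>chain_step \<pi> (\<lambda>_. K) k x \<partial>?C k)"
    if f: "f \<in> borel_measurable (PiM {0..<Suc k} ?M)" for f k
  proof -
    have "(\<integral>\<^sup>+x. f x \<partial>?C (Suc k)) = (\<integral>\<^sup>+x. \<integral>\<^sup>+y. f y \<partial>eP k x \<partial>?C k)"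
      using f by (simp, subst nn_integral_bind[where B="PiM {0..<Suc k} ?M"])
        (auto simp: measurable_cong_sets[OF sC refl] intro!: measurable_eP)
    also have "\<dots> = (\<integral>\<^sup>+x. \<integral>\<^sup>+a. f (x(k := a)) \<partial>chain_step \<pi> (\<lambda>_. K) k x \<partial>?C k)"
      using f by (intro nn_integral_cong nn_integral_eP) (auto simp: spC)
    finally show ?thesis .
  qed
  have Rm: "(\<lambda>x. (\<Prod>i<k. ennreal ((gs ! i) (x i))) * ennreal (\<phi> (x k))) \<in> borel_measurable (PiM {0..<Suc k} ?M)"
    if "\<phi> \<in> bfun" "k \<le> ?n" for \<phi> k
  proof -
    have "\<phi> \<in> borel_measurable M" using that(1) by (simp add: bfun_def)
    then have "(\<lambda>x. ennreal (\<phi> (x k))) \<in> borel_measurable (PiM {0..<Suc k} ?M)"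
      using measurable_compose[OF comp[of k "Suc k"]] by simp
    moreover have "(\<lambda>x. \<Prod>i<k. ennreal ((gs ! i) (x i))) \<in> borel_measurable (PiM {0..<Suc k} ?M)"
      using that(2) by (intro borel_measurable_prod_ennreal gm) auto
    ultimately show ?thesis by (rule borel_measurable_times_ennreal[rotated])
  qed
  have R0: "R 0 \<phi> = ennreal (stat \<phi>)" if \<phi>: "\<phi> \<in> bfun" "\<And>s. s \<in> space M \<Longrightarrow> 0 \<le> \<phi> s" for \<phi>
  proof -
    have "R 0 \<phi> = (\<integral>\<^sup>+x. \<integral>\<^sup>+a. ennreal (\<phi> a) \<partial>\<pi> \<partial>?C 0)"
      unfolding R_def using int_Suc[OF Rm[OF \<phi>(1), where k=0]] by (simp add: chain_step_def del: C.simps)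
    also have "\<dots> = ennreal (stat \<phi>) * emeasure (?C 0) (space (?C 0))"
      by (simp only: nn_integral_stat[OF \<phi>] nn_integral_const)
    also have "emeasure (?C 0) (space (?C 0)) = 1"
      by (intro prob_space.emeasure_space_1 prob_space_C) (simp add: space_PiM)
    finally show ?thesis by simp
  qed
  have RS: "R (Suc k) \<phi> = R k (\<lambda>s. (gs ! k) s * Kop \<phi> s)"
    if \<phi>: "\<phi> \<in> bfun" "\<And>s. s \<in> space M \<Longrightarrow> 0 \<le> \<phi> s" and k: "Suc k \<le> ?n" for \<phi> k
  proof -
    have \<phi>m: "\<phi> \<in> borel_measurable M" using \<phi>(1) by (simp add: bfun_def)
    have "R (Suc k) \<phi> = (\<integral>\<^sup>+x. \<integral>\<^sup>+a. (\<Prod>i<Suc k. ennreal ((gs ! i) ((x(Suc k := a)) i))) *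
        ennreal (\<phi> ((x(Suc k := a)) (Suc k))) \<partial>chain_step \<pi> (\<lambda>_. K) (Suc k) x \<partial>?C (Suc k))"
      unfolding R_def by (rule int_Suc[OF Rm[OF \<phi>(1) k]])
    also have "\<dots> = (\<integral>\<^sup>+x. (\<Prod>i<k. ennreal ((gs ! i) (x i))) * ennreal ((gs ! k) (x k) * Kop \<phi> (x k)) \<partial>?C (Suc k))"
    proof (rule nn_integral_cong)
      fix x assume "x \<in> space (?C (Suc k))"
      then have xk: "x k \<in> space M" unfolding spC by (auto simp: space_PiM PiE_iff)
      have "(\<integral>\<^sup>+a. (\<Prod>i<Suc k. ennreal ((gs ! i) ((x(Suc k := a)) i))) *
          ennreal (\<phi> ((x(Suc k := a)) (Suc k))) \<partial>chain_step \<pi> (\<lambda>_. K) (Suc k) x)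
        = (\<integral>\<^sup>+a. (\<Prod>i<Suc k. ennreal ((gs ! i) (x i))) * ennreal (\<phi> a) \<partial>K (x k))"
        by (auto simp: chain_step_def intro!: nn_integral_cong arg_cong2[where f="(*)"] prod.cong)
      also have "\<dots> = (\<Prod>i<Suc k. ennreal ((gs ! i) (x i))) * (\<integral>\<^sup>+a. ennreal (\<phi> a) \<partial>K (x k))"
        using \<phi>m by (intro nn_integral_cmult) (simp add: measurable_cong_sets[OF sets_K[OF xk] refl])
      also have "\<dots> = (\<Prod>i<k. ennreal ((gs ! i) (x i))) * (ennreal ((gs ! k) (x k)) * ennreal (Kop \<phi> (x k)))"
        by (simp add: nn_integral_K[OF \<phi> xk] mult.assoc)
      also have "ennreal ((gs ! k) (x k)) * ennreal (Kop \<phi> (x k)) = ennreal ((gs ! k) (x k) * Kop \<phi> (x k))"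
        using Kop_nonneg[OF \<phi>(2) xk] by (simp add: ennreal_mult'')
      finally show "(\<integral>\<^sup>+a. (\<Prod>i<Suc k. ennreal ((gs ! i) ((x(Suc k := a)) i))) *
          ennreal (\<phi> ((x(Suc k := a)) (Suc k))) \<partial>chain_step \<pi> (\<lambda>_. K) (Suc k) x)
        = (\<Prod>i<k. ennreal ((gs ! i) (x i))) * ennreal ((gs ! k) (x k) * Kop \<phi> (x k))" .
    qed
    finally show ?thesis by (simp only: R_def)
  qed
  have cw: "chain_weight (drop k gs) \<in> bfun" "s \<in> space M \<Longrightarrow> 0 \<le> chain_weight (drop k gs) s" for k s
    using gs set_drop_subset[of k gs] by (auto intro!: chain_weight_bfun chain_weight_nonneg)
  have "R k (chain_weight (drop k gs)) = ennreal (stat (chain_weight gs))" if "k \<le> ?n" for k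
    using that
  proof (induction k)
    case 0
    then show ?case using R0[OF cw(1)[of 0] cw(2)[of _ 0]] by simp
  next
    case (Suc k)
    have "drop k gs = gs ! k # drop (Suc k) gs" using Suc.prems by (simp add: Cons_nth_drop_Suc)
    then have "chain_weight (drop k gs) = (\<lambda>s. (gs ! k) s * Kop (chain_weight (drop (Suc k) gs)) s)" by simp
    then show ?case using RS[OF cw(1)[of "Suc k"] cw(2)[of _ "Suc k"] Suc.prems] Suc by simp
  qed
  \<comment> \<open>\<open>R ?n\<close> integrates over one coordinate more than there are factors;
    at that last coordinate \<phi> is the constant 1.\<close>
  from this[of ?n] have fin: "R ?n (\<lambda>_. 1) = ennreal (stat (chain_weight gs))" by simp
  have r: "(\<lambda>x. restrict x {0..<Suc ?n}) \<in> PF.lim \<rightarrow>\<^sub>M PiM {0..<Suc ?n} ?M"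
    by (simp add: measurable_cong_sets[OF PF.sets_lim refl] measurable_restrict_subset)
  have "R ?n (\<lambda>_. 1) = (\<integral>\<^sup>+x. (\<Prod>i<?n. ennreal ((gs ! i) (restrict x {0..<Suc ?n} i))) \<partial>PF.lim)"
    unfolding R_def D
    by (subst nn_integral_distr[OF r]) (use Rm[of "\<lambda>_. 1" ?n] in simp_all)
  also have "\<dots> = (\<integral>\<^sup>+x. (\<Prod>i<?n. ennreal ((gs ! i) (x i))) \<partial>PF.lim)"
    by (intro nn_integral_cong prod.cong) auto
  finally show ?thesis using fin by (simp add: chain_law_def)
qed

end

section \<open>Law of large numbers\<close>

text \<open>Between consecutive eighth powers \<open>a\<close> changes by at most their gap, which
  is negligible relative to j^8 because (1 + 1/j)^8 - 1 tends to 0.\<close>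

lemma ratio_tendsto_of_powers:
  fixes a :: "nat \<Rightarrow> real"
  assumes inc: "\<And>n. \<bar>a (Suc n) - a n\<bar> \<le> 1" and lim: "(\<lambda>j. a (j ^ 8) / real j ^ 8) \<longlonglongrightarrow> v"
  shows "(\<lambda>n. a n / real n) \<longlonglongrightarrow> v"
proof -
  \<comment> \<open>The largest j with j^8 \<le> n.\<close>
  define j where "j n = nat \<lfloor>root 8 (real n)\<rfloor>" for n
  have j_le: "j n ^ 8 \<le> n" for n
  proof -
    have "real (j n) \<le> root 8 (real n)" by (simp add: j_def)
    then have "real (j n) ^ 8 \<le> root 8 (real n) ^ 8" by (intro power_mono) auto
    then have "real (j n ^ 8) \<le> real n" by simp
    then show ?thesis by (simp only: of_nat_le_iff)
  qed
  have j_ge: "real n \<le> (real (j n) + 1) ^ 8" for n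
  proof -
    have "root 8 (real n) \<le> real (j n) + 1" unfolding j_def by linarith
    then have "root 8 (real n) ^ 8 \<le> (real (j n) + 1) ^ 8" by (intro power_mono) auto
    then show ?thesis by simp
  qed
  have jlim: "filterlim j at_top sequentially"
    unfolding filterlim_at_top
  proof
    fix N
    have "N \<le> j n" if "N ^ 8 \<le> n" for n
    proof -
      have "real N = root 8 (real N ^ 8)" by (simp add: real_root_power_cancel)
      also have "\<dots> \<le> root 8 (real n)" using that by (intro real_root_le_mono) (simp_all flip: of_nat_power)
      finally show ?thesis unfolding j_def by linarith
    qed
    then show "\<forall>\<^sub>F n in sequentially. N \<le> j n" by (auto simp: eventually_sequentially)
  qed
  have incr: "\<bar>a (m + k) - a m\<bar> \<le> real k" for m k
  proof (induction k)
    case (Suc k)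
    then show ?case using inc[of "m + k"] by simp
  qed simp
  have bound: "\<bar>a n / real n - v\<bar> \<le> \<bar>a (j n ^ 8) / real (j n) ^ 8 - v\<bar> + (1 + \<bar>v\<bar>) * ((1 + 1 / real (j n)) ^ 8 - 1)"
    if jn: "1 \<le> j n" for n
  proof -
    let ?N = "j n ^ 8"
    have N: "0 < real ?N" using jn by simp
    have n: "real ?N \<le> real n" using j_le[of n] by (simp only: of_nat_le_iff)
    have e: "\<bar>a n - a ?N\<bar> \<le> real n - real ?N" using incr[of ?N "n - ?N"] j_le[of n] by (simp add: of_nat_diff)
    have vv: "\<bar>v * real ?N - v * real n\<bar> = \<bar>v\<bar> * (real n - real ?N)"
      using n by (simp add: abs_mult flip: right_diff_distrib)
    have "\<bar>a n - v * real n\<bar> \<le> \<bar>a ?N - v * real ?N\<bar> + \<bar>a n - a ?N\<bar> + \<bar>v * real ?N - v * real n\<bar>" by linarith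
    also have "\<dots> \<le> \<bar>a ?N - v * real ?N\<bar> + (1 + \<bar>v\<bar>) * (real n - real ?N)"
      using e unfolding vv by (simp add: algebra_simps)
    also have "\<dots> \<le> \<bar>a ?N - v * real ?N\<bar> + (1 + \<bar>v\<bar>) * ((real (j n) + 1) ^ 8 - real ?N)"
      using j_ge[of n] by (intro add_left_mono mult_left_mono) auto
    finally have main: "\<bar>a n - v * real n\<bar> \<le> \<bar>a ?N - v * real ?N\<bar> + (1 + \<bar>v\<bar>) * ((real (j n) + 1) ^ 8 - real ?N)" .
    have n0: "0 < real n" using N n by linarith
    have "\<bar>a n / real n - v\<bar> = \<bar>a n - v * real n\<bar> / real n"
      using n0 by (simp add: field_simps abs_divide[symmetric])
    also have "\<dots> \<le> \<bar>a n - v * real n\<bar> / real ?N" using n by (intro divide_left_mono mult_pos_pos n0 N) auto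
    also have "\<dots> \<le> (\<bar>a ?N - v * real ?N\<bar> + (1 + \<bar>v\<bar>) * ((real (j n) + 1) ^ 8 - real ?N)) / real ?N"
      using N by (intro divide_right_mono main) auto
    also have "\<dots> = \<bar>a ?N - v * real ?N\<bar> / real ?N + (1 + \<bar>v\<bar>) * (((real (j n) + 1) ^ 8 - real ?N) / real ?N)"
      by (simp add: add_divide_distrib)
    also have "\<bar>a ?N - v * real ?N\<bar> / real ?N = \<bar>a ?N / real (j n) ^ 8 - v\<bar>"
      using N by (simp add: field_simps abs_divide[symmetric])
    also have "((real (j n) + 1) ^ 8 - real ?N) / real ?N = (1 + 1 / real (j n)) ^ 8 - 1"
    proof -
      have "1 + 1 / real (j n) = (real (j n) + 1) / real (j n)" using jn by (simp add: field_simps)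
      then show ?thesis using N by (simp add: power_divide diff_divide_distrib)
    qed
    finally show ?thesis .
  qed
  have "(\<lambda>n. \<bar>a (j n ^ 8) / real (j n) ^ 8 - v\<bar>) \<longlonglongrightarrow> 0"
    using filterlim_compose[OF lim jlim] by (simp add: LIM_zero tendsto_rabs_zero)
  moreover have "(\<lambda>n. 1 / real (j n)) \<longlonglongrightarrow> 0"
    by (intro real_tendsto_divide_at_top[OF tendsto_const] filterlim_compose[OF filterlim_real_sequentially jlim])
  then have "(\<lambda>n. (1 + \<bar>v\<bar>) * ((1 + 1 / real (j n)) ^ 8 - 1)) \<longlonglongrightarrow> (1 + \<bar>v\<bar>) * ((1 + 0) ^ 8 - 1)"
    by (intro tendsto_intros)
  ultimately have lim0: "(\<lambda>n. \<bar>a (j n ^ 8) / real (j n) ^ 8 - v\<bar> + (1 + \<bar>v\<bar>) * ((1 + 1 / real (j n)) ^ 8 - 1))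
      \<longlonglongrightarrow> 0 + (1 + \<bar>v\<bar>) * ((1 + 0) ^ 8 - 1)"
    by (rule tendsto_add)
  have "\<forall>\<^sub>F n in sequentially. 1 \<le> j n" using jlim by (simp add: filterlim_at_top)
  then have "\<forall>\<^sub>F n in sequentially. norm (a n / real n - v)
      \<le> \<bar>a (j n ^ 8) / real (j n) ^ 8 - v\<bar> + (1 + \<bar>v\<bar>) * ((1 + 1 / real (j n)) ^ 8 - 1)"
    by (rule eventually_mono) (simp only: real_norm_def bound)
  then have "(\<lambda>n. a n / real n - v) \<longlonglongrightarrow> 0"
    by (rule Lim_null_comparison) (use lim0 in simp)
  then show ?thesis by (simp add: LIM_zero_iff)
qed

locale minorized_rwdre =
  fixes T :: "(int ^ 'd::finite) pmf topology"
    and K :: "(int ^ 'd) pmf \<Rightarrow> (int ^ 'd) pmf measure"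
    and \<pi> :: "(int ^ 'd) pmf measure"
    and \<kappa> :: real
  assumes supp: "\<And>s. s \<in> topspace T \<Longrightarrow> set_pmf s \<subseteq> nbhd0"
    and eval: "\<And>e. e \<in> nbhd0 \<Longrightarrow> (\<lambda>s. pmf s e) \<in> borel_measurable (borel_of_top T)"
    and K: "K \<in> borel_of_top T \<rightarrow>\<^sub>M prob_algebra (borel_of_top T)"
    and stationary_\<pi>: "stationary_dist (borel_of_top T) K \<pi>"
    and \<kappa>_pos: "0 < \<kappa>" and \<kappa>_le_1: "\<kappa> \<le> 1"
    and minor: "\<And>s A. s \<in> topspace T \<Longrightarrow> A \<in> sets (borel_of_top T) \<Longrightarrow> \<kappa> * measure \<pi> A \<le> measure (K s) A"

sublocale minorized_rwdre \<subseteq> minorized_environment "borel_of_top T" K \<pi> "\<lambda>e s. pmf s e" \<kappa>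
proof
  show "(\<Sum>e\<in>nbhd0. pmf s e) = 1" if "s \<in> space (borel_of_top T)" for s
    using supp[of s] that by (intro sum_pmf_eq_1 finite_nbhd0) simp_all
qed (use eval K stationary_\<pi> \<kappa>_pos \<kappa>_le_1 minor in auto)

context minorized_rwdre
begin

abbreviation "\<P> \<equiv> annealed_paths T K \<pi> 0"

lemma sets_\<P>: "sets \<P> = sets path_space" and space_\<P> [simp]: "space \<P> = UNIV"
  by (simp_all add: annealed_paths_def)

lemma sets_env_law: "sets (env_law T K \<pi>) = sets (env_space T)"
  using env_law_prob_algebra[OF stationary_\<pi> K] by (simp add: space_prob_algebra)

lemma prob_\<P>: "prob_space \<P>"
  and emeasure_\<P>: "G \<in> sets path_space \<Longrightarrow>
    emeasure \<P> G = (\<integral>\<^sup>+\<omega>. emeasure (quenched \<omega> 0) G \<partial>env_law T K \<pi>)"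
proof -
  note A = annealed_prob_algebra[OF supp eval stationary_\<pi> K, of 0]
  have pA: "prob_space (annealed T K \<pi> 0)"
    and sA: "sets (annealed T K \<pi> 0) = sets (env_space T \<Otimes>\<^sub>M path_space)"
    using A by (simp_all add: space_prob_algebra)
  have m: "snd \<in> annealed T K \<pi> 0 \<rightarrow>\<^sub>M path_space"
    unfolding measurable_cong_sets[OF sA refl] by (rule measurable_snd)
  show "prob_space \<P>" unfolding annealed_paths_def by (rule prob_space.prob_space_distr[OF pA m])
  assume G: "G \<in> sets path_space"
  have "emeasure \<P> G = emeasure (annealed T K \<pi> 0) (snd -` G \<inter> space (annealed T K \<pi> 0))"
    unfolding annealed_paths_def by (rule emeasure_distr[OF m G])
  also have "snd -` G \<inter> space (annealed T K \<pi> 0) = space (env_space T) \<times> G"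
    unfolding sets_eq_imp_space_eq[OF sA] by (auto simp: space_pair_measure)
  also have "emeasure (annealed T K \<pi> 0) \<dots>
      = (\<integral>\<^sup>+\<omega>. indicator (space (env_space T)) \<omega> * emeasure (quenched \<omega> 0) G \<partial>env_law T K \<pi>)"
    by (rule emeasure_annealed_Times[OF supp eval stationary_\<pi> K _ G]) auto
  also have "\<dots> = (\<integral>\<^sup>+\<omega>. emeasure (quenched \<omega> 0) G \<partial>env_law T K \<pi>)"
    by (intro nn_integral_cong) (simp add: sets_eq_imp_space_eq[OF sets_env_law])
  finally show "emeasure \<P> G = (\<integral>\<^sup>+\<omega>. emeasure (quenched \<omega> 0) G \<partial>env_law T K \<pi>)" .
qed

section \<open>Cylinder probabilities under the annealed law\<close>

definition cyl :: "(int ^ 'd) list \<Rightarrow> (nat \<Rightarrow> int ^ 'd) set" where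
  "cyl es = {X. \<forall>i\<le>length es. X i = pos es 0 i}"

lemma measurable_coord [measurable]: "(\<lambda>X. X i) \<in> path_space \<rightarrow>\<^sub>M count_space UNIV"
  unfolding path_space_def by (rule measurable_component_singleton) simp

lemma sets_cyl [measurable]: "cyl es \<in> sets path_space"
proof -
  have "{X \<in> space path_space. \<forall>i\<in>{..length es}. X i = pos es 0 i} \<in> sets path_space" by measurable
  then show ?thesis by (simp add: cyl_def Ball_def)
qed

text \<open>This links the algebra to the measure: the quenched probability is a product over times,
  regrouping it by site allows independence of the sites to be used, and each site contributes its
  chain expectation, as in \<open>weight_prod\<close>.\<close>

lemma emeasure_cyl:
  assumes es: "set es \<subseteq> nbhd0"
  shows "emeasure \<P> (cyl es) = ennreal (weight (\<lambda>_. stat) 0 es)"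
proof -
  let ?n = "length es" and ?Q = "chain_law (borel_of_top T) \<pi> (\<lambda>_. K)"
  define V where "V = pos es 0 ` {..<?n}"
  have V: "finite V" by (simp add: V_def)
  have e: "es ! i \<in> nbhd0" if "i < ?n" for i using es that by auto
  let ?sw = "\<lambda>y. site_weights y 0 es"
  have Q: "?Q \<in> space (prob_algebra (PiM UNIV (\<lambda>_. borel_of_top T)))"
    using stationary_\<pi> K by (intro chain_law_prob_algebra) (auto simp: stationary_dist_def)
  then have pQ: "prob_space ?Q" and sQ: "sets ?Q = sets (PiM UNIV (\<lambda>_. borel_of_top T))"
    by (auto simp: space_prob_algebra)
  have sw: "g \<in> bfun" "s \<in> topspace T \<Longrightarrow> 0 \<le> g s" if "g \<in> set (?sw y)" for g y s
    using site_weights_set[OF es that] by auto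
  have "emeasure (quenched \<omega> 0) (cyl es) = (\<Prod>y\<in>V. \<Prod>i<?n. ennreal ((?sw y ! i) (\<omega> y i)))"
    if "\<omega> \<in> space (env_space T)" for \<omega>
  proof -
    have "emeasure (quenched \<omega> 0) (cyl es)
        = ennreal (\<Prod>i<?n. trans_prob \<omega> i (pos es 0 i) (pos es 0 (Suc i)))"
      unfolding cyl_def using emeasure_quenched_cylinder[OF supp[OF env_in_topspace[OF that]], where x=0 and n="?n" and y="pos es 0"]
      by simp
    \<comment> \<open>Factors 1 are inserted for the sites not occupied at time i, so that the two
      products can be interchanged.\<close>
    also have "\<dots> = ennreal (\<Prod>i<?n. \<Prod>y\<in>V. (?sw y ! i) (\<omega> y i))"
    proof (intro arg_cong[where f=ennreal] prod.cong refl)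
      fix i assume "i \<in> {..<?n}"
      then have i: "i < ?n" by simp
      have "(\<Prod>y\<in>V. (?sw y ! i) (\<omega> y i)) = (\<Prod>y\<in>V. if y = pos es 0 i then pmf (\<omega> y i) (es ! i) else 1)"
        using i by (intro prod.cong refl) (simp add: site_weights_nth)
      also have "\<dots> = pmf (\<omega> (pos es 0 i) i) (es ! i)"
        using i V by (subst prod.delta) (auto simp: V_def)
      finally show "trans_prob \<omega> i (pos es 0 i) (pos es 0 (Suc i)) = (\<Prod>y\<in>V. (?sw y ! i) (\<omega> y i))"
        using e[OF i] pos_Suc[OF i, of 0] by (simp add: trans_prob_def)
    qed
    also have "\<dots> = (\<Prod>i<?n. \<Prod>y\<in>V. ennreal ((?sw y ! i) (\<omega> y i)))"
    proof -
      have nn: "0 \<le> (?sw y ! i) (\<omega> y i)" if "i < ?n" for i y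
        using that by (intro sw(2)[of _ y] env_in_topspace \<open>\<omega> \<in> space (env_space T)\<close> nth_mem) simp
      have "(\<Prod>i<?n. \<Prod>y\<in>V. ennreal ((?sw y ! i) (\<omega> y i))) = (\<Prod>i<?n. ennreal (\<Prod>y\<in>V. (?sw y ! i) (\<omega> y i)))"
        by (intro prod.cong refl prod_ennreal nn) simp
      also have "\<dots> = ennreal (\<Prod>i<?n. \<Prod>y\<in>V. (?sw y ! i) (\<omega> y i))"
        by (intro prod_ennreal prod_nonneg ballI nn) simp
      finally show ?thesis by (rule sym)
    qed
    also have "\<dots> = (\<Prod>y\<in>V. \<Prod>i<?n. ennreal ((?sw y ! i) (\<omega> y i)))" by (rule prod.swap)
    finally show ?thesis .
  qed
  then have "emeasure \<P> (cyl es) = (\<integral>\<^sup>+\<omega>. (\<Prod>y\<in>V. \<Prod>i<?n. ennreal ((?sw y ! i) (\<omega> y i))) \<partial>env_law T K \<pi>)"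
    unfolding emeasure_\<P>[OF sets_cyl]
    by (intro nn_integral_cong) (simp add: sets_eq_imp_space_eq[OF sets_env_law])
  also have "\<dots> = (\<Prod>y\<in>V. \<integral>\<^sup>+X. (\<Prod>i<?n. ennreal ((?sw y ! i) (X i))) \<partial>?Q)"
    unfolding env_law_def
  proof (rule nn_integral_PiM_UNIV_prod[OF pQ V])
    fix y
    have "(\<lambda>X. \<Prod>i<?n. ennreal ((?sw y ! i) (X i))) \<in> borel_measurable (PiM UNIV (\<lambda>_. borel_of_top T))"
    proof (intro borel_measurable_prod_ennreal)
      fix i assume "i \<in> {..<?n}"
      then have "?sw y ! i \<in> bfun" by (intro sw(1)[of _ y] nth_mem) simp
      then have "?sw y ! i \<in> borel_measurable (borel_of_top T)" by (simp add: bfun_def)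
      from measurable_compose[OF measurable_component_singleton[of i UNIV "\<lambda>_. borel_of_top T"] this]
      show "(\<lambda>X. ennreal ((?sw y ! i) (X i))) \<in> borel_measurable (PiM UNIV (\<lambda>_. borel_of_top T))" by simp
    qed
    then show "(\<lambda>X. \<Prod>i<?n. ennreal ((?sw y ! i) (X i))) \<in> borel_measurable ?Q"
      by (simp add: measurable_cong_sets[OF sQ refl])
  qed
  also have "\<dots> = (\<Prod>y\<in>V. ennreal (stat (chain_weight (?sw y))))"
  proof (rule prod.cong[OF refl])
    fix y
    have "(\<integral>\<^sup>+X. (\<Prod>i<length (?sw y). ennreal ((?sw y ! i) (X i))) \<partial>?Q) = ennreal (stat (chain_weight (?sw y)))"
      by (rule nn_integral_chain_law) (use sw[of _ y] in auto)
    then show "(\<integral>\<^sup>+X. (\<Prod>i<?n. ennreal ((?sw y ! i) (X i))) \<partial>?Q) = ennreal (stat (chain_weight (?sw y)))"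
      by (simp only: length_site_weights)
  qed
  also have "\<dots> = ennreal (\<Prod>y\<in>V. stat (chain_weight (?sw y)))"
  proof (rule prod_ennreal)
    fix y
    show "0 \<le> stat (chain_weight (?sw y))"
      by (rule state_nonneg[OF state_stat chain_weight_bfun chain_weight_nonneg]) (use sw[of _ y] in auto)
  qed
  also have "(\<Prod>y\<in>V. stat (chain_weight (?sw y))) = weight (\<lambda>_. stat) 0 es"
    by (rule weight_prod[OF fam_stat es V, symmetric]) (simp add: V_def)
  finally show ?thesis .
qed

lemma cyl_disjoint:
  assumes "X \<in> cyl es" "X \<in> cyl fs" "length es = length fs"
  shows "es = fs"
proof (rule nth_equalityI[OF assms(3)])
  fix i assume i: "i < length es"
  have "X (Suc i) - X i = es ! i" "X (Suc i) - X i = fs ! i"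
    using assms i pos_Suc[of i es 0] pos_Suc[of i fs 0] by (auto simp: cyl_def)
  then show "es ! i = fs ! i" by simp
qed

text \<open>The cylinders are disjoint and their weights add up to \<open>Pop ^^ n\<close> of the
  constant 1, which is 1.\<close>

lemma AE_cyl: "AE X in \<P>. \<exists>es\<in>jumps n. X \<in> cyl es"
proof -
  interpret P: prob_space \<P> by (rule prob_\<P>)
  have "emeasure \<P> (\<Union>es\<in>jumps n. cyl es) = (\<Sum>es\<in>jumps n. emeasure \<P> (cyl es))"
  proof (rule sum_emeasure[symmetric])
    show "disjoint_family_on cyl (jumps n)"
      by (auto simp: disjoint_family_on_def jumps_def dest: cyl_disjoint)
  qed (auto simp: finite_jumps sets_\<P>)
  also have "\<dots> = (\<Sum>es\<in>jumps n. ennreal (weight (\<lambda>_. stat) 0 es))"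
    by (intro sum.cong refl emeasure_cyl) (simp add: jumps_def)
  also have "\<dots> = ennreal (\<Sum>es\<in>jumps n. weight (\<lambda>_. stat) 0 es)"
    by (intro sum_ennreal weight_nonneg fam_stat) (simp add: jumps_def)
  also have "(\<Sum>es\<in>jumps n. weight (\<lambda>_. stat) 0 es) = 1"
    using Pop_pow_paths[of n "\<lambda>_. 1" "\<lambda>_. stat" 0] Pop_pow_const[OF fam_stat, of n 1 0] by simp
  finally have "emeasure \<P> (\<Union>es\<in>jumps n. cyl es) = 1" by simp
  then have "P.prob (\<Union>es\<in>jumps n. cyl es) = 1" by (simp add: measure_def)
  moreover have "(\<Union>es\<in>jumps n. cyl es) \<in> sets \<P>"
    unfolding sets_\<P> by (intro sets.finite_UN finite_jumps sets_cyl)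
  ultimately have "AE X in \<P>. X \<in> (\<Union>es\<in>jumps n. cyl es)" by (simp only: P.AE_in_set_eq_1)
  then show ?thesis by simp
qed

text \<open>Up to a null set the path space splits into finitely many disjoint cylinders on which
  \<open>X n\<close> is constant.\<close>

lemma nn_integral_\<P>:
  assumes h: "\<And>x. 0 \<le> h x"
  shows "(\<integral>\<^sup>+X. ennreal (h (X n)) \<partial>\<P>) = ennreal ((Pop ^^ n) (\<lambda>_. h) (\<lambda>_. stat) 0)"
proof -
  have "(\<integral>\<^sup>+X. ennreal (h (X n)) \<partial>\<P>)
    = (\<integral>\<^sup>+X. (\<Sum>es\<in>jumps n. ennreal (h (pos es 0 n)) * indicator (cyl es) X) \<partial>\<P>)"
  proof (rule nn_integral_cong_AE, rule AE_mp[OF AE_cyl AE_I2], rule impI)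
    fix X assume "\<exists>es\<in>jumps n. X \<in> cyl es"
    then obtain es where es: "es \<in> jumps n" "X \<in> cyl es" by blast
    have "(\<Sum>fs\<in>jumps n. ennreal (h (pos fs 0 n)) * indicator (cyl fs) X)
        = (\<Sum>fs\<in>jumps n. if fs = es then ennreal (h (X n)) else 0)"
    proof (intro sum.cong refl)
      fix fs :: "(int ^ 'd) list" assume fs: "fs \<in> jumps n"
      show "ennreal (h (pos fs 0 n)) * indicator (cyl fs) X = (if fs = es then ennreal (h (X n)) else 0)"
      proof (cases "fs = es")
        case True
        then show ?thesis using es by (auto simp: cyl_def jumps_def)
      next
        case False
        then have "X \<notin> cyl fs" using cyl_disjoint[OF es(2), of fs] es fs by (auto simp: jumps_def)
        then show ?thesis using False by simp
      qed
    qed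
    also have "\<dots> = ennreal (h (X n))" using es by (simp add: finite_jumps)
    finally show "ennreal (h (X n)) = (\<Sum>fs\<in>jumps n. ennreal (h (pos fs 0 n)) * indicator (cyl fs) X)" by simp
  qed
  also have "\<dots> = (\<Sum>es\<in>jumps n. ennreal (h (pos es 0 n)) * emeasure \<P> (cyl es))"
    by (subst nn_integral_sum) (auto simp: sets_\<P> nn_integral_cmult_indicator
        intro!: borel_measurable_times_ennreal borel_measurable_indicator)
  also have "\<dots> = (\<Sum>es\<in>jumps n. ennreal (weight (\<lambda>_. stat) 0 es * h (pos es 0 n)))"
  proof (intro sum.cong refl)
    fix es :: "(int ^ 'd) list" assume "es \<in> jumps n"
    then have es: "set es \<subseteq> nbhd0" by (simp add: jumps_def)
    show "ennreal (h (pos es 0 n)) * emeasure \<P> (cyl es) = ennreal (weight (\<lambda>_. stat) 0 es * h (pos es 0 n))"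
      using emeasure_cyl[OF es] weight_nonneg[OF fam_stat es, of 0] h
      by (simp add: ennreal_mult mult.commute)
  qed
  also have "\<dots> = ennreal (\<Sum>es\<in>jumps n. weight (\<lambda>_. stat) 0 es * h (pos es 0 n))"
    using h by (intro sum_ennreal mult_nonneg_nonneg weight_nonneg fam_stat) (auto simp: jumps_def)
  finally show ?thesis by (simp only: Pop_pow_paths)
qed

section \<open>Almost sure convergence\<close>

lemma AE_step: "AE X in \<P>. \<forall>n. X (Suc n) - X n \<in> nbhd0"
proof (subst AE_all_countable, intro allI)
  fix n
  show "AE X in \<P>. X (Suc n) - X n \<in> nbhd0"
  proof (rule AE_mp[OF AE_cyl[of "Suc n"] AE_I2], rule impI)
    fix X assume "\<exists>es\<in>jumps (Suc n). X \<in> cyl es"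
    then obtain es where "set es \<subseteq> nbhd0" "length es = Suc n" "X \<in> cyl es" by (auto simp: jumps_def)
    moreover from this have "X (Suc n) - X n = es ! n"
      using pos_Suc[of n es 0] by (simp add: cyl_def)
    ultimately show "X (Suc n) - X n \<in> nbhd0" by (metis lessI nth_mem subsetD)
  qed
qed

text \<open>The squared deviations along the eighth powers have summable means, so their series is
  almost surely finite and its terms tend to 0. The centring converges to \<open>v\<close>, and
  bounded jumps fill the gaps.\<close>

lemma coordinate_law_of_large_numbers:
  "\<exists>v. AE X in \<P>. (\<lambda>n. real_of_int (X n $ i) / real n) \<longlonglongrightarrow> v"
proof -
  obtain v C where v: "(\<lambda>j. \<beta> i (j ^ 4) / real j ^ 4) \<longlonglongrightarrow> v"
    and C: "\<And>j. 1 \<le> j \<Longrightarrow> (Pop ^^ (j ^ 8)) (\<lambda>_ x. (real_of_int (x $ i) / real j ^ 8 - \<beta> i (j ^ 4) / real j ^ 4)\<^sup>2)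
        (\<lambda>_. stat) 0 \<le> C / real j ^ 2"
    using moment_bound[of i] by blast
  \<comment> \<open>Indexing by \<open>Suc j\<close> keeps the scale at least 1, where the moment
    bound holds.\<close>
  define Z where "Z j X = (real_of_int (X (Suc j ^ 8) $ i) / real (Suc j) ^ 8 - \<beta> i (Suc j ^ 4) / real (Suc j) ^ 4)\<^sup>2"
    for j and X :: "nat \<Rightarrow> int ^ 'd"
  have Zm: "(\<lambda>X. ennreal (Z j X)) \<in> borel_measurable \<P>" for j
    unfolding measurable_cong_sets[OF sets_\<P> refl] Z_def by measurable
  have Zi: "(\<integral>\<^sup>+X. ennreal (Z j X) \<partial>\<P>) \<le> ennreal (\<bar>C\<bar> * inverse (real (Suc j) ^ 2))" for j
  proof -
    have "(\<integral>\<^sup>+X. ennreal (Z j X) \<partial>\<P>) = ennreal ((Pop ^^ (Suc j ^ 8))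
        (\<lambda>_ x. (real_of_int (x $ i) / real (Suc j) ^ 8 - \<beta> i (Suc j ^ 4) / real (Suc j) ^ 4)\<^sup>2) (\<lambda>_. stat) 0)"
      unfolding Z_def by (rule nn_integral_\<P>) simp
    also have "\<dots> \<le> ennreal (C / real (Suc j) ^ 2)" by (intro ennreal_leI C) simp
    also have "\<dots> \<le> ennreal (\<bar>C\<bar> * inverse (real (Suc j) ^ 2))"
      by (intro ennreal_leI) (simp add: divide_inverse mult_right_mono)
    finally show ?thesis .
  qed
  have "summable (\<lambda>j. inverse (real (Suc j) ^ 2))"
    using inverse_power_summable[of 2, where 'a=real] by (subst summable_Suc_iff) simp
  then have sum: "summable (\<lambda>j. \<bar>C\<bar> * inverse (real (Suc j) ^ 2))" by (rule summable_mult)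
  have "(\<integral>\<^sup>+X. (\<Sum>j. ennreal (Z j X)) \<partial>\<P>) = (\<Sum>j. \<integral>\<^sup>+X. ennreal (Z j X) \<partial>\<P>)"
    by (rule nn_integral_suminf[OF Zm])
  also have "\<dots> \<le> (\<Sum>j. ennreal (\<bar>C\<bar> * inverse (real (Suc j) ^ 2)))" by (intro suminf_le Zi) auto
  also have "\<dots> = ennreal (\<Sum>j. \<bar>C\<bar> * inverse (real (Suc j) ^ 2))"
    by (rule suminf_ennreal2[OF _ sum]) simp
  also have "\<dots> < \<infinity>" by simp
  finally have "(\<integral>\<^sup>+X. (\<Sum>j. ennreal (Z j X)) \<partial>\<P>) \<noteq> \<infinity>" by (rule less_imp_neq)
  then have "AE X in \<P>. (\<Sum>j. ennreal (Z j X)) \<noteq> \<infinity>"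
    by (intro nn_integral_noteq_infinite borel_measurable_suminf_order Zm)
  with AE_step have "AE X in \<P>. (\<lambda>n. real_of_int (X n $ i) / real n) \<longlonglongrightarrow> v"
  proof eventually_elim
    fix X assume step: "\<forall>n. X (Suc n) - X n \<in> nbhd0" and fin: "(\<Sum>j. ennreal (Z j X)) \<noteq> \<infinity>"
    have "summable (\<lambda>j. Z j X)" using fin by (intro summable_suminf_not_top) (auto simp: Z_def)
    then have "(\<lambda>j. sqrt (Z j X)) \<longlonglongrightarrow> sqrt 0" by (intro tendsto_real_sqrt summable_LIMSEQ_zero)
    then have "(\<lambda>j. real_of_int (X (Suc j ^ 8) $ i) / real (Suc j) ^ 8 - \<beta> i (Suc j ^ 4) / real (Suc j) ^ 4) \<longlonglongrightarrow> 0"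
      by (simp add: Z_def tendsto_rabs_zero_iff)
    then have "(\<lambda>j. real_of_int (X (j ^ 8) $ i) / real j ^ 8 - \<beta> i (j ^ 4) / real j ^ 4) \<longlonglongrightarrow> 0"
      by (subst (asm) filterlim_sequentially_Suc)
    from tendsto_add[OF this v] have "(\<lambda>j. real_of_int (X (j ^ 8) $ i) / real j ^ 8) \<longlonglongrightarrow> v" by simp
    moreover have "\<bar>real_of_int (X (Suc n) $ i) - real_of_int (X n $ i)\<bar> \<le> 1" for n
    proof -
      have "\<bar>X (Suc n) $ i - X n $ i\<bar> \<le> 1" using nbhd0_component[OF step[rule_format, of n], of i] by simp
      then show ?thesis by linarith
    qed
    ultimately show "(\<lambda>n. real_of_int (X n $ i) / real n) \<longlonglongrightarrow> v"
      by (intro ratio_tendsto_of_powers)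
  qed
  then show ?thesis by blast
qed

lemma law_of_large_numbers:
  "\<exists>v :: real ^ 'd. AE X in \<P>. (\<lambda>n. (1 / real n) *\<^sub>R real_vec (X n)) \<longlonglongrightarrow> v"
proof -
  have "\<forall>i. \<exists>v. AE X in \<P>. (\<lambda>n. real_of_int (X n $ i) / real n) \<longlonglongrightarrow> v"
    using coordinate_law_of_large_numbers by blast
  from choice[OF this] obtain v
    where "\<forall>i. AE X in \<P>. (\<lambda>n. real_of_int (X n $ i) / real n) \<longlonglongrightarrow> v i" by blast
  then have "AE X in \<P>. \<forall>i. (\<lambda>n. real_of_int (X n $ i) / real n) \<longlonglongrightarrow> v i"
    by (subst AE_all_countable)
  then have "AE X in \<P>. (\<lambda>n. (1 / real n) *\<^sub>R real_vec (X n)) \<longlonglongrightarrow> (\<chi> i. v i)"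
  proof eventually_elim
    fix X assume "\<forall>i. (\<lambda>n. real_of_int (X n $ i) / real n) \<longlonglongrightarrow> v i"
    then show "(\<lambda>n. (1 / real n) *\<^sub>R real_vec (X n)) \<longlonglongrightarrow> (\<chi> i. v i)"
      by (intro vec_tendstoI) (simp add: real_vec_def)
  qed
  then show ?thesis by blast
qed

end

theorem theorem1:
  fixes T :: "(int ^ 'd::finite) pmf topology"
    and K :: "(int ^ 'd) pmf \<Rightarrow> (int ^ 'd) pmf measure"
    and \<pi> :: "(int ^ 'd) pmf measure"
    and \<kappa> \<epsilon> :: real
    and q :: "int ^ 'd \<Rightarrow> (int ^ 'd) pmf"
  assumes polish: "polish_top T"
    and supp: "\<And>s. s \<in> topspace T \<Longrightarrow> set_pmf s \<subseteq> nbhd0"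
    and eval: "\<And>e. e \<in> nbhd0 \<Longrightarrow> (\<lambda>s. pmf s e) \<in> borel_measurable (borel_of_top T)"
    and kernel: "K \<in> borel_of_top T \<rightarrow>\<^sub>M prob_algebra (borel_of_top T)"
    and stationary: "stationary_dist (borel_of_top T) K \<pi>"
    and unique: "\<And>\<mu>. stationary_dist (borel_of_top T) K \<mu> \<Longrightarrow> \<mu> = \<pi>"
    and A1: "0 < \<kappa>" "\<kappa> \<le> 1"
      "\<And>w A. w \<in> topspace T \<Longrightarrow> A \<in> sets (borel_of_top T) \<Longrightarrow> measure (K w) A \<ge> \<kappa> * measure \<pi> A"
    and A2: "0 < \<epsilon>" "\<epsilon> < 1"
      "\<And>x y. pmf (q x) y = pmf (q 0) (y - x)"
      "\<And>y. l1_norm y \<noteq> 1 \<Longrightarrow> pmf (q 0) y = 0"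
      "\<And>l. l \<noteq> 0 \<Longrightarrow> cmod (\<Sum>y | l1_norm y = 1.
          complex_of_real (pmf (q 0) y) * exp (\<i> * of_int (int_inner l y))) < 1"
      "\<And>x y t. AE \<omega> in env_law T K \<pi>. trans_prob \<omega> t x y \<ge> \<epsilon> * pmf (q x) y"
    and A3: "\<kappa> + \<epsilon>\<^sup>2 > 1"
  shows "\<exists>v :: real ^ 'd. AE X in annealed_paths T K \<pi> 0.
           (\<lambda>n. (1 / real n) *\<^sub>R real_vec (X n)) \<longlonglongrightarrow> v"
proof -
  interpret minorized_rwdre T K \<pi> \<kappa>
    by unfold_locales (use supp eval kernel stationary A1 in auto)
  show ?thesis by (rule law_of_large_numbers)
qed

end
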